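(* Let $1<p<\infty$, let $q$ be the conjugate exponent ($\frac1p+\frac1q=1$), let $\alpha>-1/p$ and $\beta=\alpha p/q$. Let $\{a_k\}\subset\mathbb B^n$. If there exist $c_1,c_2>0$ with $c_1c_2<1$ such that $$K\Bigl(\{a_k\},\tfrac{n+1}{p}+\alpha,\tfrac{n+1}{q}+\beta\Bigr)\le c_1^q\quad\text{and}\quad K\Bigl(\{a_k\},\tfrac{n+1}{q}+\beta,\tfrac{n+1}{p}+\alpha\Bigr)\le c_2^p,$$ then $\{a_k\}$ is an interpolating sequence for $B^p_\alpha$.
   Context: $\mathbb B^n$ is the unit ball of $\mathbb C^n$, $z\bar w=\sum_jz_j\bar w_j$. For $r,s>0$, $K(\{a_k\},r,s)=\sup_k\sum_{j\ne k}\frac{(1-|a_k|^2)^r(1-|a_j|^2)^s}{|1-\bar a_k a_j|^{r+s}}$. $B^p_\alpha$ is the space of holomorphic $f$ on $\mathbb B^n$ with $\|f\|_{p,\alpha}^p=\int_{\mathbb B^n}(1-|z|^2)^{\alpha p}|f|^p\,dm<\infty$. For $\gamma\in\mathbb R$, $\ell^p_\gamma(\{a_k\})$ is the space of sequences $v$ with $\sum_k((1-|a_k|^2)^\gamma|v_k|)^p<\infty$. A sequence is interpolating for $B^p_\alpha$ if for every $v\in\ell^p_{\frac{n+1}{p}+\alpha}(\{a_k\})$ there is $f\in B^p_\alpha$ with $f(a_k)=v_k$ for all $k$. *)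

theory Defs
  imports "HOL-Analysis.Analysis"
begin

definition cinner :: "complex ^ 'n \<Rightarrow> complex ^ 'n \<Rightarrow> complex" where
  "cinner z w = (\<Sum>j\<in>UNIV. z $ j * cnj (w $ j))"

definition holo_on :: "(complex ^ 'n \<Rightarrow> complex) \<Rightarrow> (complex ^ 'n) set \<Rightarrow> bool" where
  "holo_on f S \<longleftrightarrow> (\<forall>z\<in>S. \<exists>L. (f has_derivative L) (at z) \<and> (\<forall>c x. L (c *s x) = c * L x))"

definition Kconst :: "(nat \<Rightarrow> complex ^ 'n) \<Rightarrow> real \<Rightarrow> real \<Rightarrow> ennreal" where
  "Kconst a r s = (SUP k. (\<Sum>j. if j = k then 0 else
      ennreal ((1 - (norm (a k))\<^sup>2) powr r * (1 - (norm (a j))\<^sup>2) powr s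
               / (norm (1 - cinner (a j) (a k))) powr (r + s))))"

definition in_Bp :: "real \<Rightarrow> real \<Rightarrow> (complex ^ 'n \<Rightarrow> complex) \<Rightarrow> bool" where
  "in_Bp p \<alpha> f \<longleftrightarrow> holo_on f (ball 0 1) \<and>
     (\<integral>\<^sup>+ z \<in> ball 0 1. ennreal ((1 - (norm z)\<^sup>2) powr (\<alpha> * p) * norm (f z) powr p) \<partial>lborel) < \<infinity>"

definition in_lp :: "real \<Rightarrow> real \<Rightarrow> (nat \<Rightarrow> complex ^ 'n) \<Rightarrow> (nat \<Rightarrow> complex) \<Rightarrow> bool" where
  "in_lp p \<gamma> a v \<longleftrightarrow> (\<Sum>k. ennreal (((1 - (norm (a k))\<^sup>2) powr \<gamma> * norm (v k)) powr p)) < \<infinity>"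

definition interpolating :: "real \<Rightarrow> real \<Rightarrow> (nat \<Rightarrow> complex ^ 'n) \<Rightarrow> bool" where
  "interpolating p \<alpha> a \<longleftrightarrow>
     (\<forall>v. in_lp p ((real CARD('n) + 1) / p + \<alpha>) a v \<longrightarrow>
          (\<exists>f. in_Bp p \<alpha> f \<and> (\<forall>k. f (a k) = v k)))"

end

theory Submission
  imports Defs
begin

text \<open>
  Put \<open>r = (n + 1)/p + \<alpha>\<close>, \<open>s = (n + 1)/q + \<beta>\<close> and \<open>\<sigma> = r + s = n + 1 + \<alpha> p\<close>, and look for the interpolating
  function in the form \<open>f z = \<Sum>\<^sub>j u\<^sub>j (1 - |a\<^sub>j|\<^sup>2)\<^bsup>s\<^esup> (1 - \<langle>z, a\<^sub>j\<rangle>)\<^bsup>-\<sigma>\<^esup>\<close>. After weighting the values by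
  \<open>(1 - |a\<^sub>k|\<^sup>2)\<^bsup>r\<^esup>\<close>, restriction to the sequence acts on \<open>u\<close> as the identity plus an off-diagonal matrix whose
  row and column sums are the two constants \<open>K\<close>; by Schur's test its norm on \<open>\<ell>\<^sup>p\<close> is at most
  \<open>c\<^sub>1 c\<^sub>2 < 1\<close>, so a Neumann series yields \<open>u \<in> \<ell>\<^sup>p\<close>.

  Finiteness of \<open>K\<close> bounds the overlap of the Bergman-type neighbourhoods of the \<open>a\<^sub>j\<close>. Hence sums of kernels
  over the sequence are dominated by Forelli--Rudin integrals, and a weighted Schur test bounds the synthesis
  map \<open>u \<mapsto> f\<close> from \<open>\<ell>\<^sup>p\<close> to \<open>B\<^sup>p\<^sub>\<alpha>\<close>.
\<close>

section \<open>Schur's test and Neumann series in weighted sequence spaces\<close>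

text \<open>The smallness \<open>c1 * c2 < 1\<close> serves only the inversion; boundedness of the
  synthesis map needs just that \<open>K\<close> is finite. The powers in the two hypotheses come
  from Schur's test: row bound \<open>c1 powr q\<close> and column bound \<open>c2 powr p\<close>
  bound the p-th power of the norm by \<open>c2 powr p * (c1 powr q) powr (p - 1)\<close>, and
  \<open>q * (p - 1) = p\<close> turns this into \<open>(c1 * c2) powr p\<close>. The relation
  \<open>r + s = \<sigma>\<close> makes the weighted diagonal exactly the identity. The analytic
  obstacle is that \<alpha> may be negative, so that the weight is unbounded at the sphere. Kernel
  integrals are therefore cut into dyadic shells of \<open>|1 - <z, a>|\<close>, the shells are
  covered by non-isotropic caps at a boundary point, and the mass of a cap is found by Fubini with
  the singularity confined to one complex, and finally one real, variable. This avoids polar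
  coordinates and automorphisms of the ball; for the same reason explicit neighbourhoods replace
  balls of the Bergman metric.\<close>

text \<open>Jensen's inequality for the convex function \<open>x powr p\<close> and the probability
  weights \<open>N i / S\<close>; multiplying out the normalisation leaves the factor with exponent
  \<open>p - 1\<close>.\<close>

lemma sum_powr_le_weighted:
  fixes N f :: "'a \<Rightarrow> real"
  assumes "finite F" "1 < p" "\<And>i. i \<in> F \<Longrightarrow> 0 \<le> N i" "\<And>i. i \<in> F \<Longrightarrow> 0 \<le> f i"
  shows "(\<Sum>i\<in>F. N i * f i) powr p \<le> (\<Sum>i\<in>F. N i) powr (p - 1) * (\<Sum>i\<in>F. N i * f i powr p)"
proof -
  \<comment> \<open>Discarding indices with a zero weight or value keeps the convexity argument on
    the open half-line and makes the total weight positive.\<close>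
  define F' where "F' = {i \<in> F. 0 < N i \<and> 0 < f i}"
  define S where "S = (\<Sum>i\<in>F'. N i)"
  have F': "finite F'" "F' \<subseteq> F" using assms(1) by (auto simp: F'_def)
  have eq: "(\<Sum>i\<in>F. N i * f i) = (\<Sum>i\<in>F'. N i * f i)"
    using assms(1) assms(3,4) F'
    by (intro sum.mono_neutral_right) (auto simp: F'_def less_le)
  have le1: "S \<le> (\<Sum>i\<in>F. N i)" unfolding S_def
    using assms F' by (intro sum_mono2) auto
  have le2: "(\<Sum>i\<in>F'. N i * f i powr p) \<le> (\<Sum>i\<in>F. N i * f i powr p)"
    using assms F' by (intro sum_mono2) auto
  have S0: "0 \<le> S" unfolding S_def by (intro sum_nonneg) (auto simp: F'_def)
  show ?thesis
  proof (cases "F' = {}")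
    case True
    then show ?thesis using eq assms by (simp add: sum_nonneg)
  next
    case False
    have "S > 0" unfolding S_def using False F' by (intro sum_pos) (auto simp: F'_def)
    have "(\<Sum>i\<in>F'. (N i / S) *\<^sub>R f i) powr p \<le> (\<Sum>i\<in>F'. (N i / S) * f i powr p)"
      using F' False \<open>S > 0\<close> assms(2)
      by (intro convex_on_sum[OF _ _ powr_convex])
         (auto simp: sum_divide_distrib[symmetric] S_def[symmetric], auto simp: F'_def)
    also have "(\<Sum>i\<in>F'. (N i / S) *\<^sub>R f i) = (\<Sum>i\<in>F'. N i * f i) / S"
      by (simp add: sum_divide_distrib)
    also have "(\<Sum>i\<in>F'. (N i / S) * f i powr p) = (\<Sum>i\<in>F'. N i * f i powr p) / S"
      by (simp add: sum_divide_distrib)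
    finally have "(\<Sum>i\<in>F'. N i * f i) powr p / S powr p \<le> (\<Sum>i\<in>F'. N i * f i powr p) / S"
      using \<open>S > 0\<close> by (simp add: powr_divide sum_nonneg F'_def)
    then have "(\<Sum>i\<in>F'. N i * f i) powr p \<le> S powr p * ((\<Sum>i\<in>F'. N i * f i powr p) / S)"
      using \<open>S > 0\<close> by (simp add: field_simps)
    also have "\<dots> = S powr (p - 1) * (\<Sum>i\<in>F'. N i * f i powr p)"
      using \<open>S > 0\<close> by (simp add: powr_diff)
    also have "\<dots> \<le> (\<Sum>i\<in>F. N i) powr (p - 1) * (\<Sum>i\<in>F. N i * f i powr p)"
      using le1 le2 S0 assms(2) F' by (intro mult_mono powr_mono2 sum_nonneg) (auto simp: F'_def)
    finally show ?thesis using eq by simp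
  qed
qed

text \<open>Writing \<open>N x = (N h) (x / h)\<close> lets Jensen run with the weights
  \<open>N h\<close>, whose total is controlled by \<open>G\<close>. This is the pointwise half of
  the Schur test; partial sums are estimated first, and the right side may be infinite.\<close>

lemma suminf_powr_le_weighted:
  fixes N h x :: "nat \<Rightarrow> real"
  assumes p: "1 < p" and N: "\<And>j. 0 \<le> N j" and h: "\<And>j. 0 < h j" and x: "\<And>j. 0 \<le> x j"
    and G: "0 \<le> G" "(\<Sum>j. ennreal (N j * h j)) \<le> ennreal G"
    and sm: "summable (\<lambda>j. N j * x j)"
  shows "ennreal ((\<Sum>j. N j * x j) powr p)
    \<le> (\<Sum>j. ennreal (G powr (p - 1) * (N j * h j powr (1 - p) * x j powr p)))"
    (is "_ \<le> ?R")
proof (rule LIMSEQ_le_const2)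
  have h0: "0 \<le> h j" for j using h[of j] by simp
  show "(\<lambda>m. ennreal ((\<Sum>j<m. N j * x j) powr p)) \<longlonglongrightarrow> ennreal ((\<Sum>j. N j * x j) powr p)"
    using p N x by (intro tendsto_ennrealI tendsto_powr' summable_LIMSEQ[OF sm] tendsto_const)
      (auto intro!: always_eventually sum_nonneg)
  show "\<exists>M. \<forall>m\<ge>M. ennreal ((\<Sum>j<m. N j * x j) powr p) \<le> ?R"
  proof (intro exI allI impI)
    fix m :: nat
    have "ennreal (\<Sum>j<m. N j * h j) = (\<Sum>j<m. ennreal (N j * h j))"
      using N h0 by (subst sum_ennreal) auto
    also have "\<dots> \<le> (\<Sum>j. ennreal (N j * h j))"
      by (intro sum_le_suminf) auto
    finally have sG: "(\<Sum>j<m. N j * h j) \<le> G" using G order_trans by fastforce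
    have eq: "N j * h j * (x j / h j) powr p = N j * h j powr (1 - p) * x j powr p" for j
      using h[of j] x[of j] by (simp add: powr_divide powr_diff)
    have "(\<Sum>j<m. N j * x j) powr p = (\<Sum>j<m. (N j * h j) * (x j / h j)) powr p"
      using h by (auto intro!: arg_cong2[where f="(powr)"] sum.cong simp: less_imp_neq[THEN not_sym])
    also have "\<dots> \<le> (\<Sum>j<m. N j * h j) powr (p - 1) * (\<Sum>j<m. N j * h j * (x j / h j) powr p)"
      using p N h0 x by (intro sum_powr_le_weighted) auto
    also have "\<dots> \<le> G powr (p - 1) * (\<Sum>j<m. N j * h j powr (1 - p) * x j powr p)"
      unfolding eq using sG p N h0
      by (intro mult_right_mono powr_mono2) (auto intro!: sum_nonneg mult_nonneg_nonneg)
    finally have "ennreal ((\<Sum>j<m. N j * x j) powr p)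
        \<le> ennreal (\<Sum>j<m. G powr (p - 1) * (N j * h j powr (1 - p) * x j powr p))"
      by (intro ennreal_leI) (simp add: sum_distrib_left)
    also have "\<dots> = (\<Sum>j<m. ennreal (G powr (p - 1) * (N j * h j powr (1 - p) * x j powr p)))"
      using N by (subst sum_ennreal) auto
    also have "\<dots> \<le> ?R" by (intro sum_le_suminf) auto
    finally show "ennreal ((\<Sum>j<m. N j * x j) powr p) \<le> ?R" .
  qed
qed

text \<open>The pointwise bound is integrated and sum and integral are exchanged; the column
  condition returns \<open>h powr (p - 1)\<close>, which cancels the \<open>h powr (1 - p)\<close>
  left by Jensen. A general measure is allowed so that one proof covers both the interpolation
  matrix (counting measure) and the synthesis map (weighted volume).\<close>

lemma schur_test:
  fixes N :: "'a \<Rightarrow> nat \<Rightarrow> real" and h x :: "nat \<Rightarrow> real" and G :: "'a \<Rightarrow> real"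
  assumes p: "1 < p" and N: "\<And>z j. 0 \<le> N z j" and h: "\<And>j. 0 < h j" and x: "\<And>j. 0 \<le> x j"
    and G: "\<And>z. 0 \<le> G z" and C: "0 \<le> C"
    and [measurable]: "\<And>j. (\<lambda>z. N z j) \<in> borel_measurable M" "G \<in> borel_measurable M"
    and row: "\<And>z. z \<in> space M \<Longrightarrow> (\<Sum>j. ennreal (N z j * h j)) \<le> ennreal (G z)"
    and col: "\<And>j. (\<integral>\<^sup>+z. ennreal (N z j * G z powr (p - 1)) \<partial>M) \<le> ennreal (C * h j powr (p - 1))"
    and sm: "\<And>z. z \<in> space M \<Longrightarrow> summable (\<lambda>j. N z j * x j)"
  shows "(\<integral>\<^sup>+z. ennreal ((\<Sum>j. N z j * x j) powr p) \<partial>M) \<le> ennreal C * (\<Sum>j. ennreal (x j powr p))"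
proof -
  have "(\<integral>\<^sup>+z. ennreal ((\<Sum>j. N z j * x j) powr p) \<partial>M)
     \<le> (\<integral>\<^sup>+z. (\<Sum>j. ennreal (G z powr (p - 1) * (N z j * h j powr (1 - p) * x j powr p))) \<partial>M)"
    by (intro nn_integral_mono suminf_powr_le_weighted p N h x G row sm)
  also have "\<dots> = (\<Sum>j. \<integral>\<^sup>+z. ennreal (G z powr (p - 1) * (N z j * h j powr (1 - p) * x j powr p)) \<partial>M)"
    by (intro nn_integral_suminf) measurable
  also have "\<dots> = (\<Sum>j. ennreal (h j powr (1 - p) * x j powr p) * (\<integral>\<^sup>+z. ennreal (N z j * G z powr (p - 1)) \<partial>M))"
    by (subst nn_integral_cmult[symmetric])
       (auto intro!: arg_cong[where f=suminf] ext nn_integral_cong simp: ennreal_mult''[symmetric] mult_ac)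
  also have "\<dots> \<le> (\<Sum>j. ennreal (h j powr (1 - p) * x j powr p) * ennreal (C * h j powr (p - 1)))"
    by (intro suminf_le mult_left_mono col) auto
  also have "\<dots> = (\<Sum>j. ennreal C * ennreal (x j powr p))"
  proof (intro arg_cong[where f=suminf] ext)
    fix j
    have "h j powr (1 - p) * h j powr (p - 1) = 1"
      using h[of j] by (simp add: powr_add[symmetric])
    then have "h j powr (1 - p) * x j powr p * (C * h j powr (p - 1)) = C * x j powr p"
      by algebra
    moreover have "ennreal (h j powr (1 - p) * x j powr p) * ennreal (C * h j powr (p - 1))
        = ennreal (h j powr (1 - p) * x j powr p * (C * h j powr (p - 1)))"
      by (rule ennreal_mult'[symmetric]) simp
    moreover have "ennreal C * ennreal (x j powr p) = ennreal (C * x j powr p)"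
      by (rule ennreal_mult'[symmetric, OF C])
    ultimately show "ennreal (h j powr (1 - p) * x j powr p) * ennreal (C * h j powr (p - 1)) = ennreal C * ennreal (x j powr p)"
      by presburger
  qed
  also have "\<dots> = ennreal C * (\<Sum>j. ennreal (x j powr p))" by simp
  finally show ?thesis .
qed

section \<open>Neumann series for infinite matrices on p-summable sequences\<close>

lemma le_suminf_ennreal: "f j \<le> (\<Sum>j. f j)" for f :: "nat \<Rightarrow> ennreal"
  using sum_le_suminf[of f "{j}"] by simp

lemma le_of_suminf_powr_le:
  fixes x :: "nat \<Rightarrow> real"
  assumes "0 < p" "\<And>j. 0 \<le> x j" "(\<Sum>j. ennreal (x j powr p)) \<le> ennreal B" "0 \<le> B"
  shows "x j \<le> B powr (1 / p)"
proof -
  have "ennreal (x j powr p) \<le> (\<Sum>j. ennreal (x j powr p))"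
    by (rule le_suminf_ennreal)
  from order_trans[OF this assms(3)] have "x j powr p \<le> B" using assms(4) by simp
  then have "(x j powr p) powr (1 / p) \<le> B powr (1 / p)"
    using assms by (intro powr_mono2) auto
  then show ?thesis using assms by (simp add: powr_powr)
qed

lemma suminf_swap_ennreal:
  fixes f :: "nat \<Rightarrow> nat \<Rightarrow> ennreal"
  shows "(\<Sum>k. \<Sum>m. f m k) = (\<Sum>m. \<Sum>k. f m k)"
  using nn_integral_suminf[of f "count_space UNIV"] by (simp add: nn_integral_count_space_nat)

text \<open>The solution is the sum of the iterates of \<open>- A\<close> on \<open>w\<close>. The
  hypotheses concern the entrywise absolute value of \<open>A\<close> on nonnegative sequences, so
  every convergence question is settled by a positive majorant rather than by completeness of a
  normed space.\<close>

lemma neumann_series_lp: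
  fixes A :: "nat \<Rightarrow> nat \<Rightarrow> complex" and w :: "nat \<Rightarrow> complex"
  assumes p: "1 < p" and \<theta>: "0 < \<theta>" "\<theta> < 1"
    and sumA: "\<And>x B k. \<lbrakk>\<And>j. 0 \<le> x j; 0 \<le> B; (\<Sum>j. ennreal (x j powr p)) \<le> ennreal B\<rbrakk>
       \<Longrightarrow> summable (\<lambda>j. norm (A k j) * x j)"
    and normA: "\<And>x B. \<lbrakk>\<And>j. 0 \<le> x j; 0 \<le> B; (\<Sum>j. ennreal (x j powr p)) \<le> ennreal B\<rbrakk>
       \<Longrightarrow> (\<Sum>k. ennreal ((\<Sum>j. norm (A k j) * x j) powr p)) \<le> ennreal (\<theta> powr p * B)"
    and w: "(\<Sum>k. ennreal (norm (w k) powr p)) < \<infinity>"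
  obtains u where "(\<Sum>k. ennreal (norm (u k) powr p)) < \<infinity>"
    "\<And>k. u k + (\<Sum>j. A k j * u j) = w k"
proof -
  \<comment> \<open>\<open>W m\<close> is the m-th iterate of \<open>|A|\<close> on
    \<open>|w|\<close>; it dominates \<open>U m\<close>, the m-th iterate of \<open>- A\<close> on
    \<open>w\<close>, entry by entry.\<close>
  define W where "W = rec_nat (\<lambda>k. norm (w k)) (\<lambda>_ x k. \<Sum>j. norm (A k j) * x j)"
  define U where "U = rec_nat w (\<lambda>_ x k. - (\<Sum>j. A k j * x j))"
  have W0: "W 0 = (\<lambda>k. norm (w k))" and WS: "W (Suc m) = (\<lambda>k. \<Sum>j. norm (A k j) * W m j)" for m
    by (simp_all add: W_def)
  have U0: "U 0 = w" and US: "U (Suc m) = (\<lambda>k. - (\<Sum>j. A k j * U m j))" for m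
    by (simp_all add: U_def)
  obtain B where B: "0 \<le> B" "(\<Sum>k. ennreal (norm (w k) powr p)) = ennreal B"
    using w by (metis ennreal_cases infinity_ennreal_def less_irrefl)
  have W: "(\<forall>k. 0 \<le> W m k) \<and> (\<Sum>k. ennreal (W m k powr p)) \<le> ennreal ((\<theta> powr p) ^ m * B)" for m
  proof (induction m)
    case 0
    then show ?case using B by (simp add: W0)
  next
    case (Suc m)
    have "summable (\<lambda>j. norm (A k j) * W m j)" for k
      using Suc B(1) by (intro sumA[of "W m" "(\<theta> powr p) ^ m * B"]) simp_all
    then have "0 \<le> W (Suc m) k" for k
      using Suc unfolding WS by (intro suminf_nonneg) auto
    moreover have "(\<Sum>k. ennreal (W (Suc m) k powr p)) \<le> ennreal (\<theta> powr p * ((\<theta> powr p) ^ m * B))"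
      unfolding WS using Suc B(1) by (intro normA) simp_all
    ultimately show ?case by (simp add: mult_ac)
  qed
  have powpow: "(\<theta> powr p) ^ m = (\<theta> ^ m) powr p" for m
    using \<theta> by (induction m) (auto simp: powr_mult)
  have Wnn: "0 \<le> W m k" for m k using W[of m] by blast
  have smW: "summable (\<lambda>j. norm (A k j) * W m j)" for k m
    using W[of m] B(1) by (intro sumA[of "W m" "(\<theta> powr p) ^ m * B"]) simp_all
  have UW: "norm (U m k) \<le> W m k" for m k
  proof (induction m arbitrary: k)
    case 0
    then show ?case by (simp add: U0 W0)
  next
    case (Suc m)
    have s: "summable (\<lambda>j. norm (A k j * U m j))"
      by (rule summable_comparison_test'[OF smW[of k m], of 0])
         (auto simp: norm_mult intro!: mult_left_mono Suc)
    have "norm (U (Suc m) k) \<le> (\<Sum>j. norm (A k j * U m j))"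
      unfolding US using summable_norm[OF s] by simp
    also have "\<dots> \<le> W (Suc m) k"
      unfolding WS by (intro suminf_le s smW) (auto simp: norm_mult intro!: mult_left_mono Suc)
    finally show ?case .
  qed
  have Wle: "W m k \<le> \<theta> ^ m * B powr (1 / p)" for m k
  proof -
    have "W m k \<le> ((\<theta> powr p) ^ m * B) powr (1 / p)"
      using W[of m] B(1) p by (intro le_of_suminf_powr_le) simp_all
    also have "\<dots> = ((\<theta> powr p) ^ m) powr (1 / p) * B powr (1 / p)"
      using B by (subst powr_mult) auto
    also have "((\<theta> powr p) ^ m) powr (1 / p) = \<theta> ^ m"
      using \<theta> p by (simp add: powpow powr_powr)
    finally show ?thesis .
  qed
  have sW: "summable (\<lambda>m. W m k)" for k
  proof (rule summable_comparison_test'[where g="\<lambda>m. \<theta> ^ m * B powr (1 / p)" and N=0])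
    show "summable (\<lambda>m. \<theta> ^ m * B powr (1 / p))" using \<theta> by (intro summable_mult2) auto
      show "norm (W m k) \<le> \<theta> ^ m * B powr (1 / p)" for m using Wnn Wle by simp
  qed
  have sU: "summable (\<lambda>m. norm (U m k))" for k
    by (rule summable_comparison_test'[OF sW[of k], of 0]) (simp add: UW)
  define X where "X k = (\<Sum>m. W m k)" for k
  define u where "u k = (\<Sum>m. U m k)" for k
  have X0: "0 \<le> X k" for k unfolding X_def using Wnn by (intro suminf_nonneg sW) auto
  have uX: "norm (u k) \<le> X k" for k
  proof -
    have "norm (u k) \<le> (\<Sum>m. norm (U m k))" unfolding u_def by (rule summable_norm[OF sU])
    also have "\<dots> \<le> X k" unfolding X_def by (intro suminf_le UW sU sW)
    finally show ?thesis .
  qed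
  define G where "G = 1 / (1 - \<theta>)"
  have G0: "0 \<le> G" using \<theta> by (simp add: G_def)
  have Gsum: "(\<Sum>m. ennreal (\<theta> ^ m)) = ennreal G"
    using \<theta> unfolding G_def by (subst suminf_ennreal2) (auto simp: suminf_geometric)
  \<comment> \<open>Jensen with the geometric weights \<open>\<theta> ^ m\<close> takes the place of
    Minkowski's inequality. The loss \<open>(\<theta> ^ m) powr (1 - p)\<close> meets the bound
    \<open>(\<theta> ^ m) powr p * B\<close> for \<open>W m\<close>, and the product
    \<open>\<theta> ^ m * B\<close> is still summable.\<close>
  have "ennreal (X k powr p) \<le> (\<Sum>m. ennreal (G powr (p - 1) * (\<theta> ^ m) powr (1 - p) * W m k powr p))" for k
  proof -
    have "ennreal ((\<Sum>m. 1 * W m k) powr p)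
      \<le> (\<Sum>m. ennreal (G powr (p - 1) * (1 * (\<theta> ^ m) powr (1 - p) * W m k powr p)))"
    proof (rule suminf_powr_le_weighted)
      show "(\<Sum>m. ennreal (1 * \<theta> ^ m)) \<le> ennreal G" unfolding mult_1 Gsum ..
      show "summable (\<lambda>m. 1 * W m k)" unfolding mult_1 by (rule sW)
    qed (use p \<theta> Wnn G0 in auto)
    then show ?thesis unfolding mult_1 mult.assoc X_def .
  qed
  then have "(\<Sum>k. ennreal (X k powr p)) \<le> (\<Sum>k. \<Sum>m. ennreal (G powr (p - 1) * (\<theta> ^ m) powr (1 - p) * W m k powr p))"
    by (intro suminf_le) auto
  also have "\<dots> = (\<Sum>m. \<Sum>k. ennreal (G powr (p - 1) * (\<theta> ^ m) powr (1 - p) * W m k powr p))"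
    by (rule suminf_swap_ennreal)
  also have "\<dots> = (\<Sum>m. ennreal (G powr (p - 1) * (\<theta> ^ m) powr (1 - p)) * (\<Sum>k. ennreal (W m k powr p)))"
    unfolding ennreal_suminf_cmult[symmetric]
    by (intro arg_cong[where f=suminf] ext ennreal_mult') auto
  also have "\<dots> \<le> (\<Sum>m. ennreal (G powr (p - 1) * (\<theta> ^ m) powr (1 - p)) * ennreal ((\<theta> powr p) ^ m * B))"
    by (intro suminf_le mult_left_mono W[THEN conjunct2]) auto
  also have "\<dots> = (\<Sum>m. ennreal (G powr (p - 1) * B) * ennreal (\<theta> ^ m))"
  proof (intro arg_cong[where f=suminf] ext)
    fix m
    have "(\<theta> ^ m) powr (1 - p) * (\<theta> powr p) ^ m = \<theta> ^ m"
      using \<theta> unfolding powpow powr_add[symmetric] by simp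
    then have "G powr (p - 1) * (\<theta> ^ m) powr (1 - p) * ((\<theta> powr p) ^ m * B) = G powr (p - 1) * B * \<theta> ^ m"
      by (metis mult.assoc mult.commute)
    then show "ennreal (G powr (p - 1) * (\<theta> ^ m) powr (1 - p)) * ennreal ((\<theta> powr p) ^ m * B)
        = ennreal (G powr (p - 1) * B) * ennreal (\<theta> ^ m)"
      using B by (metis ennreal_mult' mult_nonneg_nonneg powr_ge_zero)
  qed
  also have "\<dots> = ennreal (G powr (p - 1) * B * G)"
    unfolding ennreal_suminf_cmult Gsum using G0 B by (intro ennreal_mult[symmetric]) auto
  finally have XB: "(\<Sum>k. ennreal (X k powr p)) \<le> ennreal (G powr (p - 1) * B * G)" .
  have sX: "summable (\<lambda>j. norm (A k j) * X j)" for k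
    using B(1) G0 by (intro sumA[OF X0 _ XB]) simp
  have "(\<Sum>k. ennreal (norm (u k) powr p)) \<le> (\<Sum>k. ennreal (X k powr p))"
    using p uX by (intro suminf_le ennreal_leI powr_mono2) auto
  then have fin: "(\<Sum>k. ennreal (norm (u k) powr p)) < \<infinity>"
    using XB by (metis ennreal_less_top infinity_ennreal_def order.strict_trans1)
  \<comment> \<open>\<open>A\<close> maps \<open>U m\<close> to \<open>- U (Suc m)\<close>, so on
    partial sums it only shifts the index; the exchange of \<open>A\<close> with the full series is
    left to a limit.\<close>
  have part: "(\<Sum>j. A k j * (\<Sum>m<M. U m j)) = (\<Sum>m<M. - U (Suc m) k)" for k M
  proof -
    have s: "summable (\<lambda>j. A k j * U m j)" for m
      by (rule summable_norm_cancel, rule summable_comparison_test'[OF smW[of k m], of 0])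
         (auto simp: norm_mult intro!: mult_left_mono UW)
    show "(\<Sum>j. A k j * (\<Sum>m<M. U m j)) = (\<Sum>m<M. - U (Suc m) k)"
      unfolding sum_distrib_left by (subst suminf_sum[OF s]) (simp add: US)
  qed
  have eq: "u k + (\<Sum>j. A k j * u j) = w k" for k
  proof -
    have bd: "norm (\<Sum>m<M. U m j) \<le> X j" for M j
    proof -
      have "norm (\<Sum>m<M. U m j) \<le> (\<Sum>m<M. W m j)"
        by (intro sum_norm_le UW)
      also have "\<dots> \<le> X j" unfolding X_def using Wnn by (intro sum_le_suminf sW) auto
      finally show ?thesis .
    qed
    \<comment> \<open>Dominated convergence for series: the majorant \<open>|A| X\<close> is
      summable because \<open>X\<close> itself has finite p-th power sum.\<close>
    have "(\<lambda>M. \<Sum>j. A k j * (\<Sum>m<M. U m j)) \<longlonglongrightarrow> (\<Sum>j. A k j * u j)"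
    proof (rule tannerys_theorem[where M="\<lambda>j. norm (A k j) * X j", THEN conjunct2, THEN conjunct2])
      show "((\<lambda>M. A k j * (\<Sum>m<M. U m j)) \<longlongrightarrow> A k j * u j) sequentially" for j
        unfolding u_def by (intro tendsto_intros summable_LIMSEQ summable_norm_cancel[OF sU])
      show "\<forall>\<^sub>F (j, M) in sequentially \<times>\<^sub>F sequentially. norm (A k j * (\<Sum>m<M. U m j)) \<le> norm (A k j) * X j"
        by (intro always_eventually) (auto simp: norm_mult intro!: mult_left_mono bd)
    qed (use sX in auto)
    moreover have "(\<lambda>M. \<Sum>j. A k j * (\<Sum>m<M. U m j)) \<longlonglongrightarrow> - (u k - w k)"
    proof -
      have "summable (\<lambda>m. U m k)" by (rule summable_norm_cancel[OF sU])
      then have "(\<lambda>m. U (Suc m) k) sums (u k - U 0 k)"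
        unfolding u_def by (subst sums_Suc_iff) (simp add: summable_sums)
      then have "(\<lambda>m. - U (Suc m) k) sums (- (u k - U 0 k))" by (rule sums_minus)
      then show ?thesis unfolding part sums_def U0 by simp
    qed
    ultimately have "(\<Sum>j. A k j * u j) = - (u k - w k)" by (rule LIMSEQ_unique)
    then show ?thesis by simp
  qed
  show thesis using that[OF fin eq] by blast
qed

section \<open>Geometry of the complex ball\<close>

lemma cinner_commute: "cinner w z = cnj (cinner z w)"
  by (simp add: cinner_def mult.commute)

lemma cinner_diff_left: "cinner (x - y) z = cinner x z - cinner y z"
  by (simp add: cinner_def sum_subtractf algebra_simps)

lemma cinner_diff_right: "cinner z (x - y) = cinner z x - cinner z y"
  by (simp add: cinner_def sum_subtractf algebra_simps)

lemma Re_cinner: "Re (cinner z w) = z \<bullet> w"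
  by (simp add: cinner_def inner_vec_def inner_complex_def)

lemma cinner_self: "cinner z z = complex_of_real ((norm z)\<^sup>2)"
proof -
  have "Im (cinner z z) = 0" by (simp add: cinner_def algebra_simps)
  then show ?thesis by (simp add: complex_eq_iff Re_cinner power2_norm_eq_inner)
qed

lemma norm_cinner_le: "norm (cinner z w) \<le> norm z * norm w"
proof -
  have "norm (cinner z w) \<le> (\<Sum>j\<in>UNIV. \<bar>norm (z $ j)\<bar> * \<bar>norm (w $ j)\<bar>)"
    unfolding cinner_def by (rule order_trans[OF norm_sum]) (simp add: norm_mult)
  also have "\<dots> \<le> norm z * norm w"
    unfolding norm_vec_def by (rule L2_set_mult_ineq)
  finally show ?thesis .
qed

lemma norm_one_minus_cinner_commute: "norm (1 - cinner w z) = norm (1 - cinner z w)"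
  using complex_mod_cnj[of "1 - cinner z w"] by (simp add: cinner_commute[of w z])

lemma continuous_on_cinner [continuous_intros]:
  assumes "continuous_on S f"
  shows "continuous_on S (\<lambda>x. cinner (f x) a)"
  unfolding cinner_def by (intro continuous_intros assms)

lemma borel_measurable_cinner [measurable]: "(\<lambda>z. cinner z a) \<in> borel_measurable borel"
  by (intro borel_measurable_continuous_onI continuous_intros)

lemma one_minus_norm_le:
  assumes "norm z \<le> 1" "norm a \<le> 1"
  shows "1 - norm a \<le> norm (1 - cinner z a)"
proof -
  have "norm (cinner z a) \<le> 1 * norm a"
    by (rule order_trans[OF norm_cinner_le]) (intro mult_right_mono assms norm_ge_zero)
  then show ?thesis using norm_triangle_ineq2[of 1 "cinner z a"] by simp
qed

lemma defect_le:
  assumes "norm z \<le> 1" "norm a \<le> 1"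
  shows "1 - (norm a)\<^sup>2 \<le> 2 * norm (1 - cinner z a)"
proof -
  have "1 - (norm a)\<^sup>2 = (1 - norm a) * (1 + norm a)" by (simp add: power2_eq_square algebra_simps)
  also have "\<dots> \<le> (1 - norm a) * 2" using assms by (intro mult_left_mono) auto
  finally show ?thesis using one_minus_norm_le[OF assms] by simp
qed

text \<open>Expanding the square leaves \<open>2 Re (1 - <z, a>)\<close>, as both norms are at most
  one. Euclidean distance is thus only of the order of the square root of the kernel's denominator,
  which is the source of the non-isotropic scales used throughout.\<close>

lemma norm_diff_sq_le:
  assumes "norm z \<le> 1" "norm a \<le> 1"
  shows "(norm (z - a))\<^sup>2 \<le> 2 * norm (1 - cinner z a)"
proof -
  have "(norm (z - a))\<^sup>2 = (norm z)\<^sup>2 + (norm a)\<^sup>2 - 2 * Re (cinner z a)"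
    by (simp add: Re_cinner power2_norm_eq_inner inner_diff_left inner_diff_right inner_commute)
  also have "\<dots> \<le> 2 * Re (1 - cinner z a)"
    using power_le_one[of "norm z" 2] power_le_one[of "norm a" 2] assms by simp
  also have "\<dots> \<le> 2 * norm (1 - cinner z a)"
    by (intro mult_left_mono complex_Re_le_cmod) auto
  finally show ?thesis .
qed

text \<open>A stand-in for the Bergman ball around \<open>a\<close>: extent of order \<open>1 - |a|\<^sup>2\<close> in the complex
  direction of \<open>a\<close> and \<open>(1 - |a|\<^sup>2)\<^bsup>1/2\<^esup>\<close> in the orthogonal directions, so that the kernel is
  comparable to a constant on it.\<close>
definition nbhd :: "complex ^ 'n \<Rightarrow> (complex ^ 'n) set" where
  "nbhd a = {w. (norm (w - a))\<^sup>2 \<le> (1 - (norm a)\<^sup>2) / 16 \<and> norm (cinner (w - a) a) \<le> (1 - (norm a)\<^sup>2) / 16}"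

lemma nbhd_measurable [measurable]: "nbhd a \<in> sets borel"
proof -
  have "closed (nbhd a)" unfolding nbhd_def
    by (intro closed_Collect_conj closed_Collect_le continuous_intros)
  then show ?thesis by (rule borel_closed)
qed

text \<open>In \<open>|w|^2 = |a|^2 + 2 Re <w - a, a> + |w - a|^2\<close> the last two terms
  together amount to at most 3/16 of the defect of \<open>a\<close>, well within the factor
  two.\<close>

lemma nbhd_defect:
  assumes "w \<in> nbhd a" "norm a < 1"
  shows "1 - (norm w)\<^sup>2 \<le> 2 * (1 - (norm a)\<^sup>2)" "1 - (norm a)\<^sup>2 \<le> 2 * (1 - (norm w)\<^sup>2)" "norm w < 1"
proof -
  let ?l = "1 - (norm a)\<^sup>2"
  have l: "?l > 0" using assms(2) by (simp add: power2_eq_square) (metis mult_strict_mono' norm_ge_zero mult_1)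
  have 1: "(norm w)\<^sup>2 = (norm a)\<^sup>2 + 2 * Re (cinner (w - a) a) + (norm (w - a))\<^sup>2"
    by (simp add: Re_cinner power2_norm_eq_inner inner_diff_left inner_diff_right inner_commute)
  have 2: "\<bar>Re (cinner (w - a) a)\<bar> \<le> ?l / 16" "(norm (w - a))\<^sup>2 \<le> ?l / 16"
    using assms(1) abs_Re_le_cmod[of "cinner (w - a) a"] unfolding nbhd_def by auto
  have arith: "1 - W \<le> 2 * (1 - A) \<and> 1 - A \<le> 2 * (1 - W)"
    if "W = A + 2 * R + D" "\<bar>R\<bar> \<le> (1 - A) / 16" "D \<le> (1 - A) / 16" "0 \<le> D" "0 < 1 - A" for W A R D :: real
    using that by (auto simp: abs_le_iff)
  have 3: "0 \<le> (norm (w - a))\<^sup>2" by simp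
  show "1 - (norm w)\<^sup>2 \<le> 2 * ?l" using arith[OF 1 2 3 l] by blast
  show 4: "?l \<le> 2 * (1 - (norm w)\<^sup>2)" using arith[OF 1 2 3 l] by blast
  have "(norm w)\<^sup>2 < 1" using 4 l by argo
  then show "norm w < 1" by (simp add: power_less_one_iff abs_square_less_1)
qed

text \<open>Passing from \<open>a\<close> to \<open>w\<close> changes \<open>1 - <z, a>\<close> by
  \<open><z, w - a> = <z - a, w - a> + <a, w - a>\<close>. With \<open>d = |1 - <z, a>|\<close>,
  Cauchy-Schwarz bounds the first part by \<open>d / 2\<close>, and the thinness of the
  neighbourhood in the direction of \<open>a\<close> bounds the second by \<open>d / 8\<close>. The
  total 5/8 is below one, so both comparisons hold uniformly up to the sphere.\<close>

lemma nbhd_kernel: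
  assumes "w \<in> nbhd a" "norm a < 1" "norm z \<le> 1"
  shows "norm (1 - cinner z w) \<le> 2 * norm (1 - cinner z a)"
    and "norm (1 - cinner z a) \<le> 4 * norm (1 - cinner z w)"
proof -
  let ?l = "1 - (norm a)\<^sup>2" and ?d = "norm (1 - cinner z a)"
  have l: "?l \<le> 2 * ?d" using defect_le[of z a] assms by simp
  have "(norm (z - a) * norm (w - a))\<^sup>2 = (norm (z - a))\<^sup>2 * (norm (w - a))\<^sup>2"
    by (simp add: power_mult_distrib)
  also have "\<dots> \<le> (2 * ?d) * (2 * ?d / 16)"
    using norm_diff_sq_le[of z a] assms l by (intro mult_mono) (auto simp: nbhd_def)
  also have "\<dots> = (?d / 2)\<^sup>2" by (simp add: power2_eq_square)
  finally have 1: "norm (z - a) * norm (w - a) \<le> ?d / 2"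
    by (rule power2_le_imp_le) simp
  have "cinner z (w - a) = cinner (z - a) (w - a) + cinner a (w - a)"
    by (simp add: cinner_diff_left)
  then have "norm (cinner z (w - a)) \<le> norm (z - a) * norm (w - a) + norm (cinner a (w - a))"
    using norm_cinner_le[of "z - a" "w - a"] norm_triangle_ineq[of "cinner (z - a) (w - a)" "cinner a (w - a)"]
    by simp
  also have "norm (cinner a (w - a)) = norm (cinner (w - a) a)"
    by (subst cinner_commute) simp
  finally have "norm (cinner z (w - a)) \<le> norm (z - a) * norm (w - a) + norm (cinner (w - a) a)" .
  moreover have "norm (cinner (w - a) a) \<le> ?l / 16" using assms(1) by (simp add: nbhd_def)
  ultimately have 2: "norm (cinner z (w - a)) \<le> 5 / 8 * ?d" using 1 l by argo
  have 3: "1 - cinner z w = (1 - cinner z a) - cinner z (w - a)" by (simp add: cinner_diff_right)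
  show "norm (1 - cinner z w) \<le> 2 * ?d"
    using norm_triangle_ineq4[of "1 - cinner z a" "cinner z (w - a)"] 2 norm_ge_zero[of "1 - cinner z a"] unfolding 3 by linarith
  show "?d \<le> 4 * norm (1 - cinner z w)"
    using norm_triangle_ineq2[of "1 - cinner z a" "cinner z (w - a)"] 2 norm_ge_zero[of "1 - cinner z a"] unfolding 3 by linarith
qed

section \<open>Integration in coordinates\<close>

lemma vec_lambda_measurable [measurable]:
  "vec_lambda \<in> (\<Pi>\<^sub>M i\<in>(UNIV::'n::finite set). (lborel :: complex measure)) \<rightarrow>\<^sub>M borel"
proof (rule borel_measurable_euclidean_space[THEN iffD2], rule ballI)
  fix b :: "complex ^ 'n" assume "b \<in> Basis"
  show "(\<lambda>x. vec_lambda x \<bullet> b) \<in> borel_measurable (\<Pi>\<^sub>M i\<in>(UNIV::'n set). (lborel :: complex measure))"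
    unfolding inner_vec_def by simp
qed

text \<open>Opens the way to Fubini with one complex coordinate singled out. Lebesgue measure is
  determined by its values on boxes, and the real basis splits into one copy of the basis of the
  plane per coordinate.\<close>

lemma lborel_vec:
  "(lborel :: (complex ^ 'n) measure) = distr (\<Pi>\<^sub>M i\<in>UNIV. lborel) borel vec_lambda"
proof (rule lborel_eqI)
  interpret product_sigma_finite "\<lambda>_::'n. lborel :: complex measure" ..
  fix l u :: "complex ^ 'n" assume le: "\<And>b. b \<in> Basis \<Longrightarrow> l \<bullet> b \<le> u \<bullet> b"
  have le': "l $ i \<bullet> b \<le> u $ i \<bullet> b" if "b \<in> Basis" for i b
    using le[of "axis i b"] that by (auto simp: Basis_vec_def inner_axis)
  have "emeasure (distr (\<Pi>\<^sub>M i\<in>UNIV. lborel) borel vec_lambda) (box l u)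
     = emeasure (\<Pi>\<^sub>M i\<in>(UNIV::'n set). (lborel :: complex measure)) (\<Pi>\<^sub>E i\<in>UNIV. box (l $ i) (u $ i))"
  proof (subst emeasure_distr)
    show "box l u \<in> sets borel" by simp
  qed (auto intro!: arg_cong2[where f=emeasure] simp: space_PiM box_def Basis_vec_def inner_axis PiE_def)
  also have "\<dots> = (\<Prod>i\<in>UNIV. emeasure lborel (box (l $ i) (u $ i)))"
    by (rule emeasure_PiM) auto
  also have "\<dots> = (\<Prod>i\<in>UNIV. ennreal (\<Prod>b\<in>Basis. (u $ i - l $ i) \<bullet> b))"
    by (intro prod.cong refl emeasure_lborel_box le')
  also have "\<dots> = ennreal (\<Prod>i\<in>UNIV. \<Prod>b\<in>Basis. (u $ i - l $ i) \<bullet> b)"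
    by (intro prod_ennreal prod_nonneg) (simp add: inner_diff_left le')
  also have "(\<Prod>i\<in>UNIV. \<Prod>b\<in>Basis. (u $ i - l $ i) \<bullet> b) = (\<Prod>b\<in>Basis. (u - l) \<bullet> b)"
  proof -
    have "(\<Prod>b\<in>Basis. (u - l) \<bullet> b) = (\<Prod>b\<in>(\<Union>i\<in>UNIV. axis i ` (Basis :: complex set)). (u - l) \<bullet> b)"
      by (intro prod.cong) (auto simp: Basis_vec_def)
    also have "\<dots> = (\<Prod>i\<in>UNIV. \<Prod>b\<in>axis i ` (Basis :: complex set). (u - l) \<bullet> b)"
      by (rule prod.UNION_disjoint) (auto simp: axis_eq_axis)
    also have "\<dots> = (\<Prod>i\<in>UNIV. \<Prod>b\<in>Basis. (u $ i - l $ i) \<bullet> b)"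
      by (intro prod.cong refl, subst prod.reindex) (auto simp: inj_on_def axis_eq_axis inner_axis)
    finally show ?thesis by simp
  qed
  finally show "emeasure (distr (\<Pi>\<^sub>M i\<in>UNIV. lborel) borel vec_lambda) (box l u) = (\<Prod>b\<in>Basis. (u - l) \<bullet> b)" .
qed simp

lemma nn_integral_vec_coordinate:
  fixes F :: "complex ^ 'n \<Rightarrow> ennreal"
  assumes [measurable]: "F \<in> borel_measurable borel"
  shows "(\<integral>\<^sup>+z. F z \<partial>lborel)
    = (\<integral>\<^sup>+x. (\<integral>\<^sup>+w. F (vec_lambda (x(i := w))) \<partial>lborel) \<partial>(\<Pi>\<^sub>M j\<in>UNIV - {i}. lborel))"
proof -
  interpret product_sigma_finite "\<lambda>_::'n. lborel :: complex measure" ..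
  have "(\<integral>\<^sup>+z. F z \<partial>lborel) = (\<integral>\<^sup>+x. F (vec_lambda x) \<partial>(\<Pi>\<^sub>M j\<in>UNIV. lborel))"
    by (subst lborel_vec, subst nn_integral_distr) auto
  also have "(UNIV :: 'n set) = insert i (UNIV - {i})" by auto
  also have "(\<integral>\<^sup>+x. F (vec_lambda x) \<partial>(\<Pi>\<^sub>M j\<in>insert i (UNIV - {i}). lborel))
    = (\<integral>\<^sup>+x. (\<integral>\<^sup>+w. F (vec_lambda (x(i := w))) \<partial>lborel) \<partial>(\<Pi>\<^sub>M j\<in>UNIV - {i}. lborel))"
  proof (rule product_nn_integral_insert)
    have "(\<lambda>x. F (vec_lambda x)) \<in> borel_measurable (\<Pi>\<^sub>M j\<in>UNIV. lborel)" by measurable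
    then show "(\<lambda>x. F (vec_lambda x)) \<in> borel_measurable (\<Pi>\<^sub>M j\<in>insert i (UNIV - {i}). lborel)"
      by (simp add: insert_absorb)
  qed auto
  finally show ?thesis .
qed

lemma emeasure_box_slice:
  fixes c :: "'n::finite \<Rightarrow> complex"
  assumes "0 \<le> r"
  shows "emeasure (\<Pi>\<^sub>M j\<in>UNIV - {i}. lborel) (\<Pi>\<^sub>E j\<in>UNIV - {i}. ball (c j) r)
    = ennreal ((unit_ball_vol 2 * r\<^sup>2) ^ (CARD('n) - 1))"
proof -
  interpret product_sigma_finite "\<lambda>_::'n. lborel :: complex measure" ..
  have "emeasure (\<Pi>\<^sub>M j\<in>UNIV - {i}. lborel) (\<Pi>\<^sub>E j\<in>UNIV - {i}. ball (c j) r)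
      = (\<Prod>j\<in>UNIV - {i}. emeasure lborel (ball (c j) r))"
    by (rule emeasure_PiM) auto
  also have "\<dots> = (\<Prod>j\<in>UNIV - {i}. ennreal (unit_ball_vol 2 * r\<^sup>2))"
    using assms by (intro prod.cong refl, subst emeasure_ball) auto
  also have "\<dots> = ennreal (unit_ball_vol 2 * r\<^sup>2) ^ (CARD('n) - 1)"
    by (simp add: card_Diff_singleton)
  finally show ?thesis using assms by (simp add: ennreal_power)
qed

text \<open>Fubini with coordinate \<open>i\<close> innermost: a slice bound that is uniform in the
  other coordinates, times the measure of the polydisc to which those are confined. In dimension one
  that polydisc is a single point of mass one.\<close>

lemma nn_integral_coordinate_le:
  fixes F :: "complex ^ 'n \<Rightarrow> ennreal"
  assumes [measurable]: "F \<in> borel_measurable borel" and r: "0 \<le> r"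
    and supp: "\<And>z j. F z \<noteq> 0 \<Longrightarrow> j \<noteq> i \<Longrightarrow> z $ j \<in> ball (c j) r"
    and inner: "\<And>x. (\<integral>\<^sup>+w. F (vec_lambda (x(i := w))) \<partial>lborel) \<le> ennreal K"
  shows "(\<integral>\<^sup>+z. F z \<partial>lborel) \<le> ennreal K * ennreal ((unit_ball_vol 2 * r\<^sup>2) ^ (CARD('n) - 1))"
proof -
  let ?B = "\<Pi>\<^sub>E j\<in>UNIV - {i}. ball (c j) r"
  have [measurable]: "?B \<in> sets (\<Pi>\<^sub>M j\<in>UNIV - {i}. (lborel :: complex measure))"
    by (intro sets_PiM_I_finite) auto
  have "(\<integral>\<^sup>+z. F z \<partial>lborel)
      = (\<integral>\<^sup>+x. (\<integral>\<^sup>+w. F (vec_lambda (x(i := w))) \<partial>lborel) \<partial>(\<Pi>\<^sub>M j\<in>UNIV - {i}. lborel))"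
    by (rule nn_integral_vec_coordinate) fact
  also have "\<dots> \<le> (\<integral>\<^sup>+x. ennreal K * indicator ?B x \<partial>(\<Pi>\<^sub>M j\<in>UNIV - {i}. lborel))"
  proof (rule nn_integral_mono)
    fix x assume x: "x \<in> space (\<Pi>\<^sub>M j\<in>UNIV - {i}. (lborel :: complex measure))"
    show "(\<integral>\<^sup>+w. F (vec_lambda (x(i := w))) \<partial>lborel) \<le> ennreal K * indicator ?B x"
    proof (cases "x \<in> ?B")
      case True
      then show ?thesis using inner[of x] by simp
    next
      case False
      then obtain j where j: "j \<noteq> i" "x j \<notin> ball (c j) r"
        using x by (auto simp: space_PiM PiE_iff)
      have "F (vec_lambda (x(i := w))) = 0" for w
        using supp[of "vec_lambda (x(i := w))" j] j by auto
      then show ?thesis by simp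
    qed
  qed
  also have "\<dots> = ennreal K * emeasure (\<Pi>\<^sub>M j\<in>UNIV - {i}. lborel) ?B"
    by (rule nn_integral_cmult_indicator) measurable
  finally show ?thesis unfolding emeasure_box_slice[OF r] .
qed

lemma emeasure_coordinate_ge:
  fixes S :: "(complex ^ 'n) set"
  assumes [measurable]: "S \<in> sets borel" and r: "0 \<le> r"
    and inner: "\<And>x. (\<And>j. j \<noteq> i \<Longrightarrow> x j \<in> ball (c j) r)
      \<Longrightarrow> ennreal K \<le> (\<integral>\<^sup>+w. indicator S (vec_lambda (x(i := w))) \<partial>lborel)"
  shows "ennreal K * ennreal ((unit_ball_vol 2 * r\<^sup>2) ^ (CARD('n) - 1)) \<le> emeasure lborel S"
proof -
  let ?B = "\<Pi>\<^sub>E j\<in>UNIV - {i}. ball (c j) r"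
  have [measurable]: "?B \<in> sets (\<Pi>\<^sub>M j\<in>UNIV - {i}. (lborel :: complex measure))"
    by (intro sets_PiM_I_finite) auto
  have "ennreal K * emeasure (\<Pi>\<^sub>M j\<in>UNIV - {i}. lborel) ?B
      = (\<integral>\<^sup>+x. ennreal K * indicator ?B x \<partial>(\<Pi>\<^sub>M j\<in>UNIV - {i}. lborel))"
    by (rule nn_integral_cmult_indicator[symmetric]) measurable
  also have "\<dots> \<le> (\<integral>\<^sup>+x. (\<integral>\<^sup>+w. indicator S (vec_lambda (x(i := w))) \<partial>lborel) \<partial>(\<Pi>\<^sub>M j\<in>UNIV - {i}. lborel))"
    using inner by (intro nn_integral_mono) (auto simp: PiE_iff split: split_indicator)
  also have "\<dots> = (\<integral>\<^sup>+z. indicator S z \<partial>lborel)"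
    by (rule nn_integral_vec_coordinate[symmetric]) measurable
  also have "\<dots> = emeasure lborel S" by simp
  finally show ?thesis unfolding emeasure_box_slice[OF r] .
qed

section \<open>Singular weights on slices in one real and one complex variable\<close>

lemma nn_integral_powr_interval:
  assumes "-1 < t" "0 \<le> r"
  shows "(\<integral>\<^sup>+x. ennreal (x powr t * indicator {0<..<r} x) \<partial>lborel) \<le> ennreal (r powr (t + 1) / (t + 1))"
proof -
  have "((\<lambda>x. x powr t * indicator {0..r} x) has_integral (r powr (t + 1) / (t + 1))) UNIV"
    using has_integral_powr_from_0[OF assms] unfolding has_integral_restrict_UNIV[symmetric, of _ _ "{0..r}"]
    by (rule has_integral_eq[rotated]) (auto simp: indicator_def)
  then have "(\<integral>\<^sup>+x. ennreal (x powr t * indicator {0..r} x) \<partial>lborel) = ennreal (r powr (t + 1) / (t + 1))"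
    by (intro nn_integral_has_integral_lborel) auto
  moreover have "(\<integral>\<^sup>+x. ennreal (x powr t * indicator {0<..<r} x) \<partial>lborel)
      \<le> (\<integral>\<^sup>+x. ennreal (x powr t * indicator {0..r} x) \<partial>lborel)"
    by (intro nn_integral_mono ennreal_leI mult_left_mono) (auto split: split_indicator)
  ultimately show ?thesis by simp
qed

text \<open>With \<open>S = sqrt R\<close> the weight factors through
  \<open>(S - |x|) (S + |x|)\<close>, and \<open>c \<le> |x|\<close> keeps the second factor away
  from zero, leaving a power of the distance to an endpoint. What matters is that the constant
  depends on neither \<open>R\<close> nor \<open>m\<close>; without the lower bound on
  \<open>|x|\<close> this uniformity fails for negative \<open>t\<close>, as \<open>R = r^2\<close>,
  \<open>m = 0\<close> and small \<open>r\<close> show.\<close>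

lemma nn_integral_slice_real:
  fixes t c :: real
  assumes t: "-1 < t" "t \<le> 0" and c: "0 < c"
  shows "\<exists>C\<ge>0. \<forall>R m r. 0 < r \<longrightarrow>
    (\<integral>\<^sup>+x. ennreal ((R - x\<^sup>2) powr t) * indicator {x. \<bar>x - m\<bar> < r \<and> c \<le> \<bar>x\<bar> \<and> x\<^sup>2 < R} x \<partial>lborel)
      \<le> ennreal (C * r powr (t + 1))"
proof (intro exI[of _ "c powr t * (2 + 2 / (t + 1))"] conjI allI impI)
  show "0 \<le> c powr t * (2 + 2 / (t + 1))" using t by auto
  fix R m r :: real assume r: "0 < r"
  define S where "S = sqrt R"
  define f where "f x = x powr t * indicator {0<..<r} x" for x :: real
  have [measurable]: "f \<in> borel_measurable borel" unfolding f_def by measurable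
  have f0: "0 \<le> f x" for x by (simp add: f_def)
  \<comment> \<open>Three cases are added up: farther than \<open>r\<close> from the endpoints the
    weight is at most of order \<open>r powr t\<close>, on an interval of length \<open>2 r\<close>;
    nearer to \<open>S\<close> or to \<open>- S\<close> it is dominated by a translate or reflection
    of \<open>f\<close>.\<close>
  have key: "(R - x\<^sup>2) powr t \<le> c powr t * (r powr t * indicator {m-r<..<m+r} x + f (S - x) + f (S + x))"
    if x: "\<bar>x - m\<bar> < r" "c \<le> \<bar>x\<bar>" "x\<^sup>2 < R" for x
  proof -
    have SR: "S\<^sup>2 = R" and S0: "S \<ge> 0" using x(3) using order_trans[OF zero_le_power2 less_imp_le[OF x(3)]] by (auto simp: S_def)
    have xS: "\<bar>x\<bar> < S" using power2_less_imp_less[of "\<bar>x\<bar>" S] x(3) SR S0 by simp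
    have Rx: "R - x\<^sup>2 = (S - \<bar>x\<bar>) * (S + \<bar>x\<bar>)"
      by (simp add: SR[symmetric] power2_eq_square algebra_simps)
    have "(S - \<bar>x\<bar>) * c \<le> R - x\<^sup>2"
      unfolding Rx using xS x S0 by (intro mult_left_mono) auto
    then have "(R - x\<^sup>2) powr t \<le> ((S - \<bar>x\<bar>) * c) powr t"
      using t xS c by (intro powr_mono2') auto
    also have "\<dots> = c powr t * (S - \<bar>x\<bar>) powr t"
      using xS c by (simp add: powr_mult)
    also have "(S - \<bar>x\<bar>) powr t \<le> r powr t * indicator {m-r<..<m+r} x + f (S - x) + f (S + x)"
    proof (cases "S - \<bar>x\<bar> < r")
      case True
      then have "(S - \<bar>x\<bar>) powr t = f (S - \<bar>x\<bar>)" using xS by (simp add: f_def)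
      also have "\<dots> \<le> f (S - x) + f (S + x)" using f0[of "S - x"] f0[of "S + x"] by (cases "x \<ge> 0") auto
      also have "\<dots> \<le> r powr t * indicator {m-r<..<m+r} x + (f (S - x) + f (S + x))" by simp
      finally show ?thesis by (simp only: add.assoc)
    next
      case False
      then have "(S - \<bar>x\<bar>) powr t \<le> r powr t" using t r by (intro powr_mono2') auto
      moreover have "indicator {m-r<..<m+r} x = (1::real)" using x(1) by (auto simp: abs_less_iff)
      ultimately show ?thesis using f0[of "S - x"] f0[of "S + x"] by simp
    qed
    finally show ?thesis by (simp add: mult_left_mono)
  qed
  have "(\<integral>\<^sup>+x. ennreal ((R - x\<^sup>2) powr t) * indicator {x. \<bar>x - m\<bar> < r \<and> c \<le> \<bar>x\<bar> \<and> x\<^sup>2 < R} x \<partial>lborel)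
    \<le> (\<integral>\<^sup>+x. ennreal (c powr t) * (ennreal (r powr t) * indicator {m-r<..<m+r} x + ennreal (f (S - x)) + ennreal (f (S + x))) \<partial>lborel)"
  proof (intro nn_integral_mono)
    fix x
    have e: "ennreal (c powr t) * (ennreal (r powr t) * indicator {m-r<..<m+r} x + ennreal (f (S - x)) + ennreal (f (S + x)))
      = ennreal (c powr t * (r powr t * indicator {m-r<..<m+r} x + f (S - x) + f (S + x)))"
      using f0 by (simp add: ennreal_mult ennreal_plus ennreal_indicator add_nonneg_nonneg)
    show "ennreal ((R - x\<^sup>2) powr t) * indicator {x. \<bar>x - m\<bar> < r \<and> c \<le> \<bar>x\<bar> \<and> x\<^sup>2 < R} x
       \<le> ennreal (c powr t) * (ennreal (r powr t) * indicator {m-r<..<m+r} x + ennreal (f (S - x)) + ennreal (f (S + x)))"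
      unfolding e by (auto split: split_indicator intro!: ennreal_leI order_trans[OF key])
  qed
  also have "\<dots> = ennreal (c powr t) * (ennreal (r powr t) * emeasure lborel {m-r<..<m+r}
      + (\<integral>\<^sup>+x. ennreal (f (S - x)) \<partial>lborel) + (\<integral>\<^sup>+x. ennreal (f (S + x)) \<partial>lborel))"
    by (subst nn_integral_cmult, measurable, subst nn_integral_add, measurable, subst nn_integral_add, measurable)
       (simp add: nn_integral_cmult_indicator)
  also have "(\<integral>\<^sup>+x. ennreal (f (S - x)) \<partial>lborel) = (\<integral>\<^sup>+x. ennreal (f x) \<partial>lborel)"
    using nn_integral_real_affine[of "\<lambda>x. ennreal (f x)" "-1" S] by simp
  also have "(\<integral>\<^sup>+x. ennreal (f (S + x)) \<partial>lborel) = (\<integral>\<^sup>+x. ennreal (f x) \<partial>lborel)"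
    using nn_integral_real_affine[of "\<lambda>x. ennreal (f x)" "1" S] by simp
  also have "emeasure lborel {m-r<..<m+r} = ennreal (2 * r)" using r by simp
  also have "ennreal (c powr t) * (ennreal (r powr t) * ennreal (2 * r)
      + (\<integral>\<^sup>+x. ennreal (f x) \<partial>lborel) + (\<integral>\<^sup>+x. ennreal (f x) \<partial>lborel))
     \<le> ennreal (c powr t) * (ennreal (r powr t) * ennreal (2 * r)
      + ennreal (r powr (t + 1) / (t + 1)) + ennreal (r powr (t + 1) / (t + 1)))"
    unfolding f_def using t r by (intro mult_left_mono add_mono nn_integral_powr_interval order_refl) auto
  also have "\<dots> = ennreal (c powr t * (r powr t * (2 * r) + r powr (t + 1) / (t + 1) + r powr (t + 1) / (t + 1)))"
  proof -
    have "ennreal a * (ennreal b * ennreal d + ennreal e + ennreal f) = ennreal (a * (b * d + e + f))"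
      if "0 \<le> a" "0 \<le> b" "0 \<le> d" "0 \<le> e" "0 \<le> f" for a b d e f
      using that by (simp add: ennreal_mult ennreal_plus)
    note * = this
    show ?thesis by (rule *) (use t r in auto)
  qed
  also have "c powr t * (r powr t * (2 * r) + r powr (t + 1) / (t + 1) + r powr (t + 1) / (t + 1))
      = c powr t * (2 + 2 / (t + 1)) * r powr (t + 1)"
    using t r by (simp add: powr_add algebra_simps)
  finally show "(\<integral>\<^sup>+x. ennreal ((R - x\<^sup>2) powr t) * indicator {x. \<bar>x - m\<bar> < r \<and> c \<le> \<bar>x\<bar> \<and> x\<^sup>2 < R} x \<partial>lborel)
      \<le> ennreal (c powr t * (2 + 2 / (t + 1)) * r powr (t + 1))" .
qed

lemma measurable_Complex [measurable]: "(\<lambda>(x, y). Complex x y) \<in> (lborel \<Otimes>\<^sub>M lborel) \<rightarrow>\<^sub>M borel"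
proof -
  have "(\<lambda>(x, y). Complex x y) = (\<lambda>p. complex_of_real (fst p) + \<i> * complex_of_real (snd p))"
    by (auto simp: complex_eq_iff)
  then show ?thesis by simp
qed

lemma lborel_complex: "lborel = distr (lborel \<Otimes>\<^sub>M lborel) borel (\<lambda>(x, y). Complex x y)"
proof (rule lborel_eqI)
  fix l u :: complex assume le: "\<And>b. b \<in> Basis \<Longrightarrow> l \<bullet> b \<le> u \<bullet> b"
  have le': "Re l \<le> Re u" "Im l \<le> Im u"
    using le[of 1] le[of \<i>] by (auto simp: Basis_complex_def)
  have "emeasure (distr (lborel \<Otimes>\<^sub>M lborel) borel (\<lambda>(x, y). Complex x y)) (box l u)
     = emeasure (lborel \<Otimes>\<^sub>M lborel) ({Re l<..<Re u} \<times> {Im l<..<Im u})"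
    by (subst emeasure_distr) (auto intro!: arg_cong2[where f=emeasure]
       simp: space_pair_measure in_box_complex_iff)
  also have "\<dots> = emeasure lborel {Re l<..<Re u} * emeasure lborel {Im l<..<Im u}"
    by (rule lborel.emeasure_pair_measure_Times) auto
  also have "\<dots> = (\<Prod>b\<in>Basis. (u - l) \<bullet> b)"
    using le' by (simp add: Basis_complex_def ennreal_mult inner_diff_left)
  finally show "emeasure (distr (lborel \<Otimes>\<^sub>M lborel) borel (\<lambda>(x, y). Complex x y)) (box l u) = (\<Prod>b\<in>Basis. (u - l) \<bullet> b)" .
qed simp

lemma nn_integral_complex_Re_Im:
  assumes [measurable]: "F \<in> borel_measurable borel"
  shows "(\<integral>\<^sup>+w. F w \<partial>lborel) = (\<integral>\<^sup>+x. \<integral>\<^sup>+y. F (Complex x y) \<partial>lborel \<partial>lborel)"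
    and "(\<integral>\<^sup>+w. F w \<partial>lborel) = (\<integral>\<^sup>+y. \<integral>\<^sup>+x. F (Complex x y) \<partial>lborel \<partial>lborel)"
proof -
  have "(\<integral>\<^sup>+w. F w \<partial>lborel) = (\<integral>\<^sup>+p. F ((\<lambda>(x, y). Complex x y) p) \<partial>(lborel \<Otimes>\<^sub>M lborel))"
    by (subst lborel_complex, subst nn_integral_distr) auto
  also have "\<dots> = (\<integral>\<^sup>+p. (case p of (x, y) \<Rightarrow> F (Complex x y)) \<partial>(lborel \<Otimes>\<^sub>M lborel))"
    by (simp add: case_prod_beta)
  finally have e: "(\<integral>\<^sup>+w. F w \<partial>lborel) = \<dots>" .
  have m [measurable]: "(\<lambda>(x, y). F (Complex x y)) \<in> borel_measurable (lborel \<Otimes>\<^sub>M lborel)"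
    using measurable_compose[OF measurable_Complex assms] by (simp add: case_prod_beta)
  show "(\<integral>\<^sup>+w. F w \<partial>lborel) = (\<integral>\<^sup>+x. \<integral>\<^sup>+y. F (Complex x y) \<partial>lborel \<partial>lborel)"
    unfolding e using lborel.nn_integral_fst[OF m] by simp
  show "(\<integral>\<^sup>+w. F w \<partial>lborel) = (\<integral>\<^sup>+y. \<integral>\<^sup>+x. F (Complex x y) \<partial>lborel \<partial>lborel)"
    unfolding e using lborel_pair.nn_integral_snd[OF m] by simp
qed

lemma nn_integral_slice_complex:
  fixes t c :: real
  assumes t: "-1 < t" "t \<le> 0" and c: "0 < c"
  shows "\<exists>C\<ge>0. \<forall>R m r. 0 < r \<longrightarrow>
    (\<integral>\<^sup>+w. ennreal ((R - (norm w)\<^sup>2) powr t) * indicator {w. w \<in> ball m r \<and> c \<le> norm w \<and> (norm w)\<^sup>2 < R} w \<partial>(lborel :: complex measure))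
      \<le> ennreal (C * r powr (t + 2))"
proof -
  obtain C where C: "C \<ge> 0" "\<And>R m r. 0 < r \<Longrightarrow>
    (\<integral>\<^sup>+x. ennreal ((R - x\<^sup>2) powr t) * indicator {x. \<bar>x - m\<bar> < r \<and> c / 2 \<le> \<bar>x\<bar> \<and> x\<^sup>2 < R} x \<partial>lborel)
      \<le> ennreal (C * r powr (t + 1))"
    using nn_integral_slice_real[OF t, of "c / 2"] c by auto
  show ?thesis
  proof (intro exI[of _ "4 * C"] conjI allI impI)
    show "0 \<le> 4 * C" using C by simp
    fix R r :: real and m :: complex assume r: "0 < r"
    define H where "H R m x = ennreal ((R - x\<^sup>2) powr t) * indicator {x. \<bar>x - m\<bar> < r \<and> c / 2 \<le> \<bar>x\<bar> \<and> x\<^sup>2 < R} x" for R m x :: real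
    define I where "I m x = (indicator {m-r<..<m+r} x :: ennreal)" for m x :: real
    have [measurable]: "H R' m' \<in> borel_measurable borel" "I m' \<in> borel_measurable borel" for R' m'
      unfolding H_def I_def by measurable
    \<comment> \<open>\<open>F1\<close> equals the integrand where the real part is large,
      \<open>F2\<close> where the imaginary part is large, so their sum dominates it.\<close>
    define F1 where "F1 w = I (Im m) (Im w) * H (R - (Im w)\<^sup>2) (Re m) (Re w)" for w
    define F2 where "F2 w = I (Re m) (Re w) * H (R - (Re w)\<^sup>2) (Im m) (Im w)" for w
    have [measurable]: "F1 \<in> borel_measurable borel" "F2 \<in> borel_measurable borel"
      unfolding F1_def F2_def H_def I_def by measurable
    have i1: "(\<integral>\<^sup>+w. F1 w \<partial>lborel) \<le> ennreal (C * r powr (t + 1)) * ennreal (2 * r)"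
    proof -
      have "(\<integral>\<^sup>+w. F1 w \<partial>lborel) = (\<integral>\<^sup>+y. \<integral>\<^sup>+x. I (Im m) y * H (R - y\<^sup>2) (Re m) x \<partial>lborel \<partial>lborel)"
        by (subst nn_integral_complex_Re_Im(2)) (auto simp: F1_def)
      also have "\<dots> = (\<integral>\<^sup>+y. I (Im m) y * (\<integral>\<^sup>+x. H (R - y\<^sup>2) (Re m) x \<partial>lborel) \<partial>lborel)"
        by (intro nn_integral_cong nn_integral_cmult) auto
      also have "\<dots> \<le> (\<integral>\<^sup>+y. ennreal (C * r powr (t + 1)) * I (Im m) y \<partial>lborel)"
        unfolding H_def by (intro nn_integral_mono) (subst mult.commute, intro mult_right_mono C r, simp)
      also have "\<dots> = ennreal (C * r powr (t + 1)) * ennreal (2 * r)"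
        unfolding I_def using r by (subst nn_integral_cmult_indicator) auto
      finally show ?thesis .
    qed
    have i2: "(\<integral>\<^sup>+w. F2 w \<partial>lborel) \<le> ennreal (C * r powr (t + 1)) * ennreal (2 * r)"
    proof -
      have "(\<integral>\<^sup>+w. F2 w \<partial>lborel) = (\<integral>\<^sup>+x. \<integral>\<^sup>+y. I (Re m) x * H (R - x\<^sup>2) (Im m) y \<partial>lborel \<partial>lborel)"
        by (subst nn_integral_complex_Re_Im(1)) (auto simp: F2_def)
      also have "\<dots> = (\<integral>\<^sup>+x. I (Re m) x * (\<integral>\<^sup>+y. H (R - x\<^sup>2) (Im m) y \<partial>lborel) \<partial>lborel)"
        by (intro nn_integral_cong nn_integral_cmult) auto
      also have "\<dots> \<le> (\<integral>\<^sup>+x. ennreal (C * r powr (t + 1)) * I (Re m) x \<partial>lborel)"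
        unfolding H_def by (intro nn_integral_mono) (subst mult.commute, intro mult_right_mono C r, simp)
      also have "\<dots> = ennreal (C * r powr (t + 1)) * ennreal (2 * r)"
        unfolding I_def using r by (subst nn_integral_cmult_indicator) auto
      finally show ?thesis .
    qed
    have "(\<integral>\<^sup>+w. ennreal ((R - (norm w)\<^sup>2) powr t) * indicator {w. w \<in> ball m r \<and> c \<le> norm w \<and> (norm w)\<^sup>2 < R} w \<partial>(lborel :: complex measure))
      \<le> (\<integral>\<^sup>+w. F1 w + F2 w \<partial>lborel)"
    proof (intro nn_integral_mono)
      fix w :: complex
      show "ennreal ((R - (norm w)\<^sup>2) powr t) * indicator {w. w \<in> ball m r \<and> c \<le> norm w \<and> (norm w)\<^sup>2 < R} w \<le> F1 w + F2 w"
      proof (cases "w \<in> ball m r \<and> c \<le> norm w \<and> (norm w)\<^sup>2 < R")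
        case True
        have n: "(norm w)\<^sup>2 = (Re w)\<^sup>2 + (Im w)\<^sup>2" by (rule cmod_power2)
        have "\<bar>Re w - Re m\<bar> \<le> norm (w - m)" "\<bar>Im w - Im m\<bar> \<le> norm (w - m)"
          using abs_Re_le_cmod[of "w - m"] abs_Im_le_cmod[of "w - m"] by auto
        then have d: "\<bar>Re w - Re m\<bar> < r" "\<bar>Im w - Im m\<bar> < r"
          using True by (auto simp: dist_norm norm_minus_commute)
        have "norm w \<le> \<bar>Re w\<bar> + \<bar>Im w\<bar>" by (rule cmod_le)
        then consider "c / 2 \<le> \<bar>Re w\<bar>" | "c / 2 \<le> \<bar>Im w\<bar>" using True by linarith
        then show ?thesis
        proof cases
          case 1
          have "F1 w = ennreal ((R - (norm w)\<^sup>2) powr t)"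
            using 1 d True unfolding F1_def H_def I_def n by (auto simp: abs_less_iff algebra_simps)
          then show ?thesis using True by simp
        next
          case 2
          have "F2 w = ennreal ((R - (norm w)\<^sup>2) powr t)"
            using 2 d True unfolding F2_def H_def I_def n by (auto simp: abs_less_iff algebra_simps)
          then show ?thesis using True by simp
        qed
      qed simp
    qed
    also have "\<dots> = (\<integral>\<^sup>+w. F1 w \<partial>lborel) + (\<integral>\<^sup>+w. F2 w \<partial>lborel)"
      by (rule nn_integral_add) auto
    also have "\<dots> \<le> ennreal (C * r powr (t + 1)) * ennreal (2 * r) + ennreal (C * r powr (t + 1)) * ennreal (2 * r)"
      by (intro add_mono i1 i2)
    also have "\<dots> = ennreal (C * r powr (t + 1) * (2 * r) + C * r powr (t + 1) * (2 * r))"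
    proof -
      have "ennreal a * ennreal b + ennreal d * ennreal e = ennreal (a * b + d * e)"
        if "0 \<le> a" "0 \<le> b" "0 \<le> d" "0 \<le> e" for a b d e
        using that by (simp add: ennreal_mult ennreal_plus)
      note * = this
    show ?thesis by (rule *) (use C(1) r in auto)
    qed
    also have "C * r powr (t + 1) * (2 * r) + C * r powr (t + 1) * (2 * r) = 4 * C * r powr (t + 2)"
      using r powr_add[of r "t + 1" 1] by (simp add: algebra_simps)
    finally show "(\<integral>\<^sup>+w. ennreal ((R - (norm w)\<^sup>2) powr t) * indicator {w. w \<in> ball m r \<and> c \<le> norm w \<and> (norm w)\<^sup>2 < R} w \<partial>(lborel :: complex measure))
      \<le> ennreal (4 * C * r powr (t + 2))" .
  qed
qed

section \<open>The Forelli--Rudin estimate\<close>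

lemma norm_sq_vec: "(norm z)\<^sup>2 = (\<Sum>j\<in>UNIV. (norm (z $ j))\<^sup>2)" for z :: "complex ^ 'n"
  by (simp add: norm_vec_def L2_set_def sum_nonneg)

lemma norm_sq_vec_upd:
  "(norm (vec_lambda (x(i := w)) :: complex ^ 'n))\<^sup>2 = (norm w)\<^sup>2 + (\<Sum>j\<in>UNIV - {i}. (norm (x j))\<^sup>2)"
  by (simp add: norm_sq_vec sum.remove[of UNIV i])

lemma exists_max_coordinate:
  fixes z :: "complex ^ 'n"
  obtains i where "\<And>j. norm (z $ j) \<le> norm (z $ i)" "norm z \<le> sqrt CARD('n) * norm (z $ i)"
proof -
  let ?N = "range (\<lambda>j. norm (z $ j))"
  have "Max ?N \<in> ?N" by (intro Max_in) auto
  then obtain i where i: "Max ?N = norm (z $ i)" by (rule imageE)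
  have le: "norm (z $ j) \<le> norm (z $ i)" for j unfolding i[symmetric] by (intro Max_ge) auto
  have "(norm z)\<^sup>2 \<le> (\<Sum>j\<in>(UNIV :: 'n set). (norm (z $ i))\<^sup>2)"
    unfolding norm_sq_vec by (intro sum_mono power_mono le) auto
  also have "\<dots> = (sqrt CARD('n) * norm (z $ i))\<^sup>2" by (simp add: power_mult_distrib)
  finally have "norm z \<le> sqrt CARD('n) * norm (z $ i)" by (rule power2_le_imp_le) simp
  then show thesis using that le by blast
qed

text \<open>Cap estimates reduce to a single complex coordinate \<open>z\<^sub>i\<close> that stays away from \<open>0\<close>: the
  singularity of \<open>(1 - |z|\<^sup>2)\<^bsup>t\<^esup>\<close> is then integrated out in that coordinate alone.\<close>
lemma weighted_volume_slices:
  fixes t c :: real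
  assumes t: "-1 < t" "t \<le> 0" and c: "0 < c"
  shows "\<exists>C\<ge>0. \<forall>(X :: (complex ^ 'n) set) i d r m. X \<in> sets borel \<longrightarrow> 0 < r \<longrightarrow> 0 < m \<longrightarrow>
      (\<forall>z. z \<in> X \<longrightarrow> norm z < 1 \<and> c \<le> norm (z $ i) \<and> (\<forall>j. j \<noteq> i \<longrightarrow> z $ j \<in> ball (d j) r)) \<longrightarrow>
      (\<forall>x. \<exists>e. \<forall>w. vec_lambda (x(i := w)) \<in> X \<longrightarrow> w \<in> ball e m) \<longrightarrow>
    (\<integral>\<^sup>+z. ennreal ((1 - (norm z)\<^sup>2) powr t) * indicator X z \<partial>lborel)
      \<le> ennreal (C * m powr (t + 2)) * ennreal ((unit_ball_vol 2 * r\<^sup>2) ^ (CARD('n) - 1))"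
proof -
  obtain C where C: "C \<ge> 0" "\<And>R m r. 0 < r \<Longrightarrow>
    (\<integral>\<^sup>+w. ennreal ((R - (norm w)\<^sup>2) powr t) * indicator {w. w \<in> ball m r \<and> c \<le> norm w \<and> (norm w)\<^sup>2 < R} w \<partial>(lborel :: complex measure))
      \<le> ennreal (C * r powr (t + 2))"
    using nn_integral_slice_complex[OF t c] by auto
  show ?thesis
  proof (rule exI[of _ C], rule conjI, rule C(1), intro allI impI)
    fix X :: "(complex ^ 'n) set" and i d r m
    assume X [measurable]: "X \<in> sets borel" and r: "0 < r" and m: "0 < m"
      and sub: "\<forall>z. z \<in> X \<longrightarrow> norm z < 1 \<and> c \<le> norm (z $ i) \<and> (\<forall>j. j \<noteq> i \<longrightarrow> z $ j \<in> ball (d j) r)"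
      and slice: "\<forall>x. \<exists>e. \<forall>w. vec_lambda (x(i := w)) \<in> X \<longrightarrow> w \<in> ball e m"
    show "(\<integral>\<^sup>+z. ennreal ((1 - (norm z)\<^sup>2) powr t) * indicator X z \<partial>lborel)
      \<le> ennreal (C * m powr (t + 2)) * ennreal ((unit_ball_vol 2 * r\<^sup>2) ^ (CARD('n) - 1))"
    proof (rule nn_integral_coordinate_le[where i=i and c=d])
      show "z $ j \<in> ball (d j) r" if "ennreal ((1 - (norm z)\<^sup>2) powr t) * indicator X z \<noteq> 0" "j \<noteq> i" for z j
        using that sub by (auto split: split_indicator_asm)
      fix x :: "'n \<Rightarrow> complex"
      obtain e where e: "\<And>w. vec_lambda (x(i := w)) \<in> X \<Longrightarrow> w \<in> ball e m" using slice by blast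
      \<comment> \<open>The other coordinates enter the weight only through \<open>R\<close>, so the
        slice constant does not depend on them.\<close>
      define R where "R = 1 - (\<Sum>j\<in>UNIV - {i}. (norm (x j))\<^sup>2)"
      have n: "1 - (norm (vec_lambda (x(i := w)) :: complex ^ 'n))\<^sup>2 = R - (norm w)\<^sup>2" for w
        by (simp add: norm_sq_vec_upd R_def)
      have "(\<integral>\<^sup>+w. ennreal ((1 - (norm (vec_lambda (x(i := w)) :: complex ^ 'n))\<^sup>2) powr t) * indicator X (vec_lambda (x(i := w))) \<partial>lborel)
        \<le> (\<integral>\<^sup>+w. ennreal ((R - (norm w)\<^sup>2) powr t) * indicator {w. w \<in> ball e m \<and> c \<le> norm w \<and> (norm w)\<^sup>2 < R} w \<partial>(lborel :: complex measure))"
      proof (intro nn_integral_mono)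
        fix w
        have "w \<in> ball e m \<and> c \<le> norm w \<and> (norm w)\<^sup>2 < R" if "vec_lambda (x(i := w)) \<in> X"
        proof -
          from sub that have "norm (vec_lambda (x(i := w)) :: complex ^ 'n) < 1" "c \<le> norm ((vec_lambda (x(i := w)) :: complex ^ 'n) $ i)" by blast+
          moreover from this(1) have "0 < 1 - (norm (vec_lambda (x(i := w)) :: complex ^ 'n))\<^sup>2"
            by (simp add: abs_square_less_1)
          ultimately show ?thesis using e[OF that] unfolding n by simp
        qed
        then show "ennreal ((1 - (norm (vec_lambda (x(i := w)) :: complex ^ 'n))\<^sup>2) powr t) * indicator X (vec_lambda (x(i := w)))
          \<le> ennreal ((R - (norm w)\<^sup>2) powr t) * indicator {w. w \<in> ball e m \<and> c \<le> norm w \<and> (norm w)\<^sup>2 < R} w"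
          unfolding n by (auto split: split_indicator)
      qed
      also have "\<dots> \<le> ennreal (C * m powr (t + 2))" by (rule C(2)[OF m])
      finally show "(\<integral>\<^sup>+w. ennreal ((1 - (norm (vec_lambda (x(i := w)) :: complex ^ 'n))\<^sup>2) powr t) * indicator X (vec_lambda (x(i := w))) \<partial>lborel)
        \<le> ennreal (C * m powr (t + 2))" .
    qed (use r in auto)
  qed
qed

section \<open>Mass of the ball and of non-isotropic caps\<close>

text \<open>On \<open>|z| \<le> 1/2\<close> the weight is bounded. Elsewhere the largest coordinate
  has modulus at least \<open>|z| / sqrt n\<close>, hence at least \<open>c\<close>, so finitely
  many sets \<open>X i\<close> cover the rest and each is integrable by slices.\<close>

lemma weighted_volume_ball:
  assumes t: "-1 < t" "t \<le> 0"
  shows "(\<integral>\<^sup>+z. ennreal ((1 - (norm z)\<^sup>2) powr t) * indicator (ball 0 1) z \<partial>(lborel :: (complex ^ 'n) measure)) < \<infinity>"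
proof -
  define c where "c = 1 / (2 * sqrt CARD('n))"
  have c: "c > 0" by (simp add: c_def)
  obtain C where C0: "C \<ge> 0" and C: "\<forall>(X :: (complex ^ 'n) set) i d r m. X \<in> sets borel \<longrightarrow> 0 < r \<longrightarrow> 0 < m \<longrightarrow>
      (\<forall>z. z \<in> X \<longrightarrow> norm z < 1 \<and> c \<le> norm (z $ i) \<and> (\<forall>j. j \<noteq> i \<longrightarrow> z $ j \<in> ball (d j) r)) \<longrightarrow>
      (\<forall>x. \<exists>e. \<forall>w. vec_lambda (x(i := w)) \<in> X \<longrightarrow> w \<in> ball e m) \<longrightarrow>
    (\<integral>\<^sup>+z. ennreal ((1 - (norm z)\<^sup>2) powr t) * indicator X z \<partial>lborel)
      \<le> ennreal (C * m powr (t + 2)) * ennreal ((unit_ball_vol 2 * r\<^sup>2) ^ (CARD('n) - 1))"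
    using weighted_volume_slices[OF t c, where 'n='n] by (elim exE conjE) (rule that)
  define X where "X i = {z :: complex ^ 'n. norm z < 1 \<and> c \<le> norm (z $ i)}" for i
  have Xm [measurable]: "X i \<in> sets borel" for i
  proof -
    have "X i = ball 0 1 \<inter> {z. c \<le> norm (z $ i)}" by (auto simp: X_def)
    moreover have "closed {z :: complex ^ 'n. c \<le> norm (z $ i)}"
      by (intro closed_Collect_le continuous_intros)
    ultimately show ?thesis by (simp add: borel_closed sets.Int)
  qed
  define J where "J i = (\<integral>\<^sup>+z. ennreal ((1 - (norm z)\<^sup>2) powr t) * indicator (X i) z \<partial>lborel)" for i
  have J: "J i < \<infinity>" for i
  proof -
    have nj: "norm (z $ j) < 1" if "norm z < 1" for z :: "complex ^ 'n" and j
      using Finite_Cartesian_Product.norm_nth_le[of z j] that by linarith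
    have "J i \<le> ennreal (C * 1 powr (t + 2)) * ennreal ((unit_ball_vol 2 * 1\<^sup>2) ^ (CARD('n) - 1))"
      unfolding J_def
    proof (rule C[rule_format, of _ _ _ i "\<lambda>_. 0"])
      show "norm z < 1 \<and> c \<le> norm (z $ i) \<and> (\<forall>j. j \<noteq> i \<longrightarrow> z $ j \<in> ball 0 1)" if "z \<in> X i" for z
        using that nj by (auto simp: X_def)
      show "\<exists>e. \<forall>w. vec_lambda (x(i := w)) \<in> X i \<longrightarrow> w \<in> ball e 1" for x
      proof (intro exI[of _ 0] allI impI)
        fix w assume "vec_lambda (x(i := w)) \<in> X i"
        then show "w \<in> ball 0 1" using nj[of "vec_lambda (x(i := w))" i] by (simp add: X_def)
      qed
    qed (use Xm in auto)
    also have "\<dots> < \<infinity>" by (simp add: ennreal_mult_less_top)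
    finally show ?thesis .
  qed
  have "(\<integral>\<^sup>+z. ennreal ((1 - (norm z)\<^sup>2) powr t) * indicator (ball 0 1) z \<partial>(lborel :: (complex ^ 'n) measure))
    \<le> (\<integral>\<^sup>+z. ennreal ((3/4) powr t) * indicator (ball 0 1) z + (\<Sum>i\<in>UNIV. ennreal ((1 - (norm z)\<^sup>2) powr t) * indicator (X i) z) \<partial>(lborel :: (complex ^ 'n) measure))"
  proof (intro nn_integral_mono)
    fix z :: "complex ^ 'n"
    let ?w = "ennreal ((1 - (norm z)\<^sup>2) powr t)"
    show "?w * indicator (ball 0 1) z \<le> ennreal ((3/4) powr t) * indicator (ball 0 1) z + (\<Sum>i\<in>UNIV. ?w * indicator (X i) z)"
    proof (cases "norm z < 1")
      case True
      show ?thesis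
      proof (cases "norm z \<le> 1/2")
        case True
        have "(norm z)\<^sup>2 \<le> (1/2)\<^sup>2" using True by (intro power_mono) auto
        then have "?w \<le> ennreal ((3/4) powr t)"
          using t by (intro ennreal_leI powr_mono2') (auto simp: power2_eq_square)
        then show ?thesis by (auto simp: add_increasing2 split: split_indicator)
      next
        case False
        obtain i where "norm z \<le> sqrt CARD('n) * norm (z $ i)" by (rule exists_max_coordinate)
        then have "z \<in> X i" using False True unfolding X_def c_def by (auto simp: field_simps)
        then have "?w \<le> ?w * indicator (X i) z" by simp
        also have "\<dots> \<le> (\<Sum>i\<in>UNIV. ?w * indicator (X i) z)"
          by (rule member_le_sum) auto
        finally show ?thesis by (auto simp: add_increasing split: split_indicator)
      qed
    qed simp
  qed
  also have "\<dots> = ennreal ((3/4) powr t) * emeasure lborel (ball 0 1 :: (complex ^ 'n) set) + (\<Sum>i\<in>UNIV. J i)"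
  proof -
    let ?f = "\<lambda>z :: complex ^ 'n. ennreal ((3/4) powr t) * indicator (ball 0 1) z"
    let ?g = "\<lambda>i (z :: complex ^ 'n). ennreal ((1 - (norm z)\<^sup>2) powr t) * indicator (X i) z"
    have g: "?g i \<in> borel_measurable lborel" for i
      by measurable
    have f: "?f \<in> borel_measurable lborel"
      by (intro borel_measurable_times_ennreal borel_measurable_const borel_measurable_indicator) (simp add: borel_open)
    have sg: "(\<lambda>z. \<Sum>i\<in>UNIV. ?g i z) \<in> borel_measurable lborel"
      by (rule borel_measurable_sum) (rule g)
    have "(\<integral>\<^sup>+z. ?f z + (\<Sum>i\<in>UNIV. ?g i z) \<partial>lborel) = (\<integral>\<^sup>+z. ?f z \<partial>lborel) + (\<integral>\<^sup>+z. (\<Sum>i\<in>UNIV. ?g i z) \<partial>lborel)"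
      by (rule nn_integral_add[OF f sg])
    also have "(\<integral>\<^sup>+z. (\<Sum>i\<in>UNIV. ?g i z) \<partial>lborel) = (\<Sum>i\<in>UNIV. J i)"
      unfolding J_def by (rule nn_integral_sum) (rule g)
    also have "(\<integral>\<^sup>+z. ?f z \<partial>lborel) = ennreal ((3/4) powr t) * emeasure lborel (ball 0 1 :: (complex ^ 'n) set)"
      by (rule nn_integral_cmult_indicator) simp
    finally show ?thesis .
  qed
  also have "\<dots> < \<infinity>"
    using J by (simp add: ennreal_mult_less_top emeasure_ball)
  finally show ?thesis .
qed

text \<open>A small cap has radius of order \<open>\<delta>\<close> in one complex direction and
  \<open>sqrt \<delta>\<close> in the remaining \<open>n - 1\<close>. The slice in the direction of
  the largest coordinate of \<open>\<zeta>\<close> gives \<open>\<delta> powr (t + 2)\<close> and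
  the others \<open>\<delta> ^ (n - 1)\<close>, which multiply to the stated power. Large caps are
  bounded by the mass of the ball.\<close>

lemma weighted_volume_cap_nonpos:
  assumes t: "-1 < t" "t \<le> 0"
  shows "\<exists>C\<ge>0. \<forall>(\<zeta> :: complex ^ 'n) \<delta>. norm \<zeta> = 1 \<longrightarrow> 0 < \<delta> \<longrightarrow>
    (\<integral>\<^sup>+z. ennreal ((1 - (norm z)\<^sup>2) powr t) * indicator {z. norm z < 1 \<and> norm (1 - cinner z \<zeta>) < \<delta>} z \<partial>lborel)
      \<le> ennreal (C * \<delta> powr (real CARD('n) + 1 + t))"
proof -
  define n where "n = real CARD('n)"
  have n: "n \<ge> 1" unfolding n_def using finite_UNIV_card_ge_0[where 'a='n] by auto
  define c where "c = 1 / (2 * sqrt n)"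
  have c: "c > 0" using n by (simp add: c_def)
  \<comment> \<open>Chosen so that \<open>sqrt (2 * \<delta>0) = c\<close>: in a smaller cap
    \<open>z $ i\<close> differs from \<open>\<zeta> $ i\<close>, of modulus at least
    \<open>2 * c\<close>, by at most \<open>c\<close>.\<close>
  define \<delta>0 where "\<delta>0 = 1 / (8 * n)"
  have \<delta>0: "\<delta>0 > 0" using n by (simp add: \<delta>0_def)
  obtain C1 where C10: "C1 \<ge> 0" and C1: "\<forall>(X :: (complex ^ 'n) set) i d r m. X \<in> sets borel \<longrightarrow> 0 < r \<longrightarrow> 0 < m \<longrightarrow>
      (\<forall>z. z \<in> X \<longrightarrow> norm z < 1 \<and> c \<le> norm (z $ i) \<and> (\<forall>j. j \<noteq> i \<longrightarrow> z $ j \<in> ball (d j) r)) \<longrightarrow>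
      (\<forall>x. \<exists>e. \<forall>w. vec_lambda (x(i := w)) \<in> X \<longrightarrow> w \<in> ball e m) \<longrightarrow>
    (\<integral>\<^sup>+z. ennreal ((1 - (norm z)\<^sup>2) powr t) * indicator X z \<partial>lborel)
      \<le> ennreal (C1 * m powr (t + 2)) * ennreal ((unit_ball_vol 2 * r\<^sup>2) ^ (CARD('n) - 1))"
    using weighted_volume_slices[OF t c, where 'n='n] by (elim exE conjE) (rule that)
  obtain C0 where C0: "C0 \<ge> 0"
    "(\<integral>\<^sup>+z. ennreal ((1 - (norm z)\<^sup>2) powr t) * indicator (ball 0 1) z \<partial>(lborel :: (complex ^ 'n) measure)) = ennreal C0"
    using weighted_volume_ball[OF t, where 'n='n]
    by (cases "(\<integral>\<^sup>+z. ennreal ((1 - (norm z)\<^sup>2) powr t) * indicator (ball 0 1) z \<partial>(lborel :: (complex ^ 'n) measure))") auto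
  define D1 where "D1 = C1 * sqrt n powr (t + 2) * (unit_ball_vol 2 * 2) ^ (CARD('n) - 1)"
  \<comment> \<open>Normalised so that the total mass \<open>C0\<close> is already covered at
    \<open>\<delta> = \<delta>0\<close>, hence for all larger caps.\<close>
  define D0 where "D0 = C0 / \<delta>0 powr (n + 1 + t)"
  have D: "D1 \<ge> 0" "D0 \<ge> 0" using C0 C10 by (auto simp: D1_def D0_def)
  show ?thesis unfolding n_def[symmetric]
  proof (rule exI[of _ "D0 + D1"], intro conjI allI impI)
    show "0 \<le> D0 + D1" using D by simp
    fix \<zeta> :: "complex ^ 'n" and \<delta> :: real assume \<zeta>: "norm \<zeta> = 1" and \<delta>: "0 < \<delta>"
    define X where "X = {z. norm z < 1 \<and> norm (1 - cinner z \<zeta>) < \<delta>}"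
    have [measurable]: "X \<in> sets borel"
    proof -
      have "open X" unfolding X_def
        by (intro open_Collect_conj open_Collect_less continuous_intros)
      then show ?thesis by simp
    qed
    have "(\<integral>\<^sup>+z. ennreal ((1 - (norm z)\<^sup>2) powr t) * indicator X z \<partial>lborel) \<le> ennreal ((D0 + D1) * \<delta> powr (n + 1 + t))"
    proof (cases "\<delta> \<le> \<delta>0")
      case False
      have "(\<integral>\<^sup>+z. ennreal ((1 - (norm z)\<^sup>2) powr t) * indicator X z \<partial>lborel) \<le> ennreal C0"
        unfolding C0(2)[symmetric] by (intro nn_integral_mono) (auto simp: X_def split: split_indicator)
      also have "C0 = D0 * \<delta>0 powr (n + 1 + t)" using \<delta>0 by (simp add: D0_def)
      also have "\<dots> \<le> (D0 + D1) * \<delta> powr (n + 1 + t)"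
        using D False \<delta>0 n t by (intro mult_mono powr_mono2) auto
      finally show ?thesis by (simp add: ennreal_leI)
    next
      case True
      obtain i where i: "norm \<zeta> \<le> sqrt CARD('n) * norm (\<zeta> $ i)" by (rule exists_max_coordinate)
      have \<zeta>i: "1 / sqrt n \<le> norm (\<zeta> $ i)" using i \<zeta> n by (simp add: n_def field_simps)
      then have \<zeta>i0: "\<zeta> $ i \<noteq> 0" using n by auto
      have dist: "norm (z - \<zeta>) < sqrt (2 * \<delta>)" if "z \<in> X" for z
      proof -
        have "(norm (z - \<zeta>))\<^sup>2 \<le> 2 * norm (1 - cinner z \<zeta>)"
          using that \<zeta> by (intro norm_diff_sq_le) (auto simp: X_def)
        also have "\<dots> < 2 * \<delta>" using that by (simp add: X_def)
        finally show ?thesis by (simp add: real_less_rsqrt)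
      qed
      have s: "sqrt (2 * \<delta>) \<le> c"
      proof (rule real_le_lsqrt)
        show "2 * \<delta> \<le> c\<^sup>2" using True n by (simp add: c_def \<delta>0_def power_divide field_simps)
      qed (use c in auto)
      have "(\<integral>\<^sup>+z. ennreal ((1 - (norm z)\<^sup>2) powr t) * indicator X z \<partial>lborel)
         \<le> ennreal (C1 * (sqrt n * \<delta>) powr (t + 2)) * ennreal ((unit_ball_vol 2 * (sqrt (2 * \<delta>))\<^sup>2) ^ (CARD('n) - 1))"
      proof (rule C1[rule_format, where i=i and d="\<lambda>j. \<zeta> $ j"])
        show "norm z < 1 \<and> c \<le> norm (z $ i) \<and> (\<forall>j. j \<noteq> i \<longrightarrow> z $ j \<in> ball (\<zeta> $ j) (sqrt (2 * \<delta>)))"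
          if z: "z \<in> X" for z
        proof (intro conjI allI impI)
          show "norm z < 1" using z by (simp add: X_def)
          have nj: "norm (z $ j - \<zeta> $ j) < sqrt (2 * \<delta>)" for j
            using Finite_Cartesian_Product.norm_nth_le[of "z - \<zeta>" j] dist[OF z] by simp
          then show "z $ j \<in> ball (\<zeta> $ j) (sqrt (2 * \<delta>))" for j
            by (simp add: dist_norm norm_minus_commute)
          have "norm (\<zeta> $ i) - norm (z $ i) \<le> norm (z $ i - \<zeta> $ i)"
            by (metis norm_minus_commute norm_triangle_ineq2)
          moreover have "1 / sqrt n = 2 * c" using n by (simp add: c_def)
          ultimately show "c \<le> norm (z $ i)" using nj[of i] s \<zeta>i by linarith
        qed
        show "\<exists>e. \<forall>w. vec_lambda (x(i := w)) \<in> X \<longrightarrow> w \<in> ball e (sqrt n * \<delta>)" for x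
        proof (intro allI exI impI)
          fix w assume "vec_lambda (x(i := w)) \<in> X"
          then have less: "norm (1 - cinner (vec_lambda (x(i := w))) \<zeta>) < \<delta>" by (simp add: X_def)
          let ?s = "\<Sum>j\<in>UNIV - {i}. x j * cnj (\<zeta> $ j)"
          have "cinner (vec_lambda (x(i := w))) \<zeta> = w * cnj (\<zeta> $ i) + ?s"
            by (simp add: cinner_def sum.remove[of UNIV i])
          \<comment> \<open>In \<open>w\<close> the expression is affine with slope of modulus at
            least \<open>1 / sqrt n\<close>; its zero is the centre of the slice, which therefore
            lies in a disc of radius \<open>sqrt n * \<delta>\<close>.\<close>
          then have "1 - cinner (vec_lambda (x(i := w))) \<zeta> = ((1 - ?s) / cnj (\<zeta> $ i) - w) * cnj (\<zeta> $ i)"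
            using \<zeta>i0 by (simp add: field_simps)
          then have "norm ((1 - ?s) / cnj (\<zeta> $ i) - w) * norm (\<zeta> $ i) < \<delta>"
            using less by (simp add: norm_mult)
          moreover have "norm ((1 - ?s) / cnj (\<zeta> $ i) - w) * (1 / sqrt n) \<le> norm ((1 - ?s) / cnj (\<zeta> $ i) - w) * norm (\<zeta> $ i)"
            by (intro mult_left_mono \<zeta>i) simp
          ultimately have "norm ((1 - ?s) / cnj (\<zeta> $ i) - w) * (1 / sqrt n) < \<delta>" by linarith
          then show "w \<in> ball ((1 - ?s) / cnj (\<zeta> $ i)) (sqrt n * \<delta>)"
            using n by (simp add: dist_norm field_simps)
        qed
      qed (use \<delta> n in auto)
      also have "\<dots> = ennreal (C1 * (sqrt n * \<delta>) powr (t + 2) * (unit_ball_vol 2 * (sqrt (2 * \<delta>))\<^sup>2) ^ (CARD('n) - 1))"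
        using C10 by (intro ennreal_mult[symmetric]) auto
      also have "C1 * (sqrt n * \<delta>) powr (t + 2) * (unit_ball_vol 2 * (sqrt (2 * \<delta>))\<^sup>2) ^ (CARD('n) - 1)
          = D1 * (\<delta> powr (t + 2) * \<delta> ^ (CARD('n) - 1))"
        using \<delta> n by (simp add: D1_def powr_mult power_mult_distrib)
      also have "\<delta> powr (t + 2) * \<delta> ^ (CARD('n) - 1) = \<delta> powr (n + 1 + t)"
      proof -
        have "\<delta> ^ (CARD('n) - 1) = \<delta> powr (n - 1)"
          using \<delta> n by (simp add: powr_realpow[symmetric] n_def of_nat_diff)
        then show ?thesis by (simp add: powr_add[symmetric] algebra_simps)
      qed
      also have "D1 * \<delta> powr (n + 1 + t) \<le> (D0 + D1) * \<delta> powr (n + 1 + t)"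
        using D by (intro mult_right_mono) auto
      finally show ?thesis by (simp add: ennreal_leI)
    qed
    then show "(\<integral>\<^sup>+z. ennreal ((1 - (norm z)\<^sup>2) powr t) * indicator {z. norm z < 1 \<and> norm (1 - cinner z \<zeta>) < \<delta>} z \<partial>lborel)
      \<le> ennreal ((D0 + D1) * \<delta> powr (n + 1 + t))" unfolding X_def .
  qed
qed

text \<open>For positive \<open>t\<close> nothing is singular: within a cap the defect is at most
  \<open>2 * \<delta>\<close>, so the weight can be pulled out and the case \<open>t = 0\<close>
  finishes.\<close>

lemma weighted_volume_cap:
  assumes t: "-1 < t"
  shows "\<exists>C\<ge>0. \<forall>(\<zeta> :: complex ^ 'n) \<delta>. norm \<zeta> = 1 \<longrightarrow> 0 < \<delta> \<longrightarrow>
    (\<integral>\<^sup>+z. ennreal ((1 - (norm z)\<^sup>2) powr t) * indicator {z. norm z < 1 \<and> norm (1 - cinner z \<zeta>) < \<delta>} z \<partial>lborel)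
      \<le> ennreal (C * \<delta> powr (real CARD('n) + 1 + t))"
proof (cases "t \<le> 0")
  case True
  show ?thesis by (rule weighted_volume_cap_nonpos[OF t True])
next
  case False
  obtain C where C0: "C \<ge> 0" and C: "\<forall>(\<zeta> :: complex ^ 'n) \<delta>. norm \<zeta> = 1 \<longrightarrow> 0 < \<delta> \<longrightarrow>
    (\<integral>\<^sup>+z. ennreal ((1 - (norm z)\<^sup>2) powr 0) * indicator {z. norm z < 1 \<and> norm (1 - cinner z \<zeta>) < \<delta>} z \<partial>lborel)
      \<le> ennreal (C * \<delta> powr (real CARD('n) + 1 + 0))"
  proof -
    have "(-1::real) < 0" "(0::real) \<le> 0" by auto
    from weighted_volume_cap_nonpos[OF this, where 'n='n] show ?thesis by (elim exE conjE) (rule that)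
  qed
  show ?thesis
  proof (rule exI[of _ "2 powr t * C"], intro conjI allI impI)
    show "0 \<le> 2 powr t * C" using C0 by simp
    fix \<zeta> :: "complex ^ 'n" and \<delta> :: real assume \<zeta>: "norm \<zeta> = 1" and \<delta>: "0 < \<delta>"
    define X where "X = {z. norm z < 1 \<and> norm (1 - cinner z \<zeta>) < \<delta>}"
    have [measurable]: "X \<in> sets borel"
    proof -
      have "open X" unfolding X_def
        by (intro open_Collect_conj open_Collect_less continuous_intros)
      then show ?thesis by simp
    qed
    have "(\<integral>\<^sup>+z. ennreal ((1 - (norm z)\<^sup>2) powr t) * indicator X z \<partial>lborel)
      \<le> (\<integral>\<^sup>+z. ennreal ((2 * \<delta>) powr t) * (ennreal ((1 - (norm z)\<^sup>2) powr 0) * indicator X z) \<partial>lborel)"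
    proof (intro nn_integral_mono)
      fix z
      show "ennreal ((1 - (norm z)\<^sup>2) powr t) * indicator X z \<le> ennreal ((2 * \<delta>) powr t) * (ennreal ((1 - (norm z)\<^sup>2) powr 0) * indicator X z)"
      proof (cases "z \<in> X")
        case True
        then have z: "norm z < 1" "norm (1 - cinner z \<zeta>) < \<delta>" by (auto simp: X_def)
        have p: "0 < 1 - (norm z)\<^sup>2" using z(1) by (simp add: abs_square_less_1)
        have "1 - (norm z)\<^sup>2 \<le> 2 * norm (1 - cinner \<zeta> z)" using \<zeta> z by (intro defect_le) auto
        also have "\<dots> \<le> 2 * \<delta>" using z(2) norm_one_minus_cinner_commute[of \<zeta> z] by simp
        finally have "(1 - (norm z)\<^sup>2) powr t \<le> (2 * \<delta>) powr t" using False p by (intro powr_mono2) auto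
        \<comment> \<open>Positivity of the base matters here, since \<open>0 powr 0\<close> is
          \<open>0\<close>.\<close>
        moreover have "(1 - (norm z)\<^sup>2) powr 0 = 1" using p by simp
        ultimately show ?thesis using True by (simp only: indicator_simps mult_1_right ennreal_1) (rule ennreal_leI)
      qed simp
    qed
    also have "\<dots> = ennreal ((2 * \<delta>) powr t) * (\<integral>\<^sup>+z. ennreal ((1 - (norm z)\<^sup>2) powr 0) * indicator X z \<partial>lborel)"
      by (rule nn_integral_cmult) measurable
    also have "\<dots> \<le> ennreal ((2 * \<delta>) powr t) * ennreal (C * \<delta> powr (real CARD('n) + 1 + 0))"
      using C[rule_format, OF \<zeta> \<delta>] unfolding X_def by (rule mult_left_mono) simp
    also have "\<dots> = ennreal ((2 * \<delta>) powr t * (C * \<delta> powr (real CARD('n) + 1 + 0)))"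
      by (rule ennreal_mult'[symmetric]) simp
    also have "(2 * \<delta>) powr t * (C * \<delta> powr (real CARD('n) + 1 + 0)) = 2 powr t * C * \<delta> powr (real CARD('n) + 1 + t)"
      using \<delta> by (simp add: powr_mult powr_add)
    finally show "(\<integral>\<^sup>+z. ennreal ((1 - (norm z)\<^sup>2) powr t) * indicator {z. norm z < 1 \<and> norm (1 - cinner z \<zeta>) < \<delta>} z \<partial>lborel)
      \<le> ennreal (2 powr t * C * \<delta> powr (real CARD('n) + 1 + t))" unfolding X_def .
  qed
qed

section \<open>Dyadic decomposition and kernel integrals\<close>

lemma exists_dyadic_scale:
  assumes "0 < r" "r \<le> (d :: real)"
  obtains m where "2 ^ m * r \<le> d" "d < 2 ^ Suc m * r"
proof -
  define m where "m = (LEAST m. d < 2 ^ Suc m * r)"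
  obtain k :: nat where "d / r < 2 ^ k" using real_arch_pow[of 2 "d / r"] by auto
  then have "d < 2 ^ k * r" using assms by (simp add: field_simps)
  also have "\<dots> \<le> 2 ^ Suc k * r" using assms by simp
  finally have m: "d < 2 ^ Suc m * r" unfolding m_def by (rule LeastI)
  have "2 ^ m * r \<le> d"
  proof (cases m)
    case 0
    then show ?thesis using assms by simp
  next
    case (Suc l)
    then have "\<not> d < 2 ^ Suc l * r" using not_less_Least[of l "\<lambda>m. d < 2 ^ Suc m * r"] by (simp add: m_def)
    then show ?thesis using Suc by simp
  qed
  then show thesis using m that by blast
qed

lemma exists_radial_projection:
  fixes a :: "complex ^ 'n"
  assumes "norm a < 1"
  obtains \<zeta> where "norm \<zeta> = 1" "norm (\<zeta> - a) = 1 - norm a"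
proof (cases "a = 0")
  case True
  have "norm (axis undefined 1 :: complex ^ 'n) = 1" by simp
  then show ?thesis using that[of "axis undefined 1"] True by simp
next
  case False
  let ?\<zeta> = "(1 / norm a) *\<^sub>R a"
  have "?\<zeta> - a = ((1 - norm a) / norm a) *\<^sub>R a" using False by (simp add: diff_divide_distrib scaleR_diff_left)
  then have "norm (?\<zeta> - a) = 1 - norm a" using False assms by simp
  then show ?thesis using that[of ?\<zeta>] False by simp
qed

text \<open>On the shell where \<open>|1 - <z, a>|\<close> is about \<open>2 ^ m * r\<close>, with
  \<open>r = 1 - |a|\<close>, the kernel is at most \<open>(2 ^ m * r) powr (- (E + c))\<close> and
  the shell lies in a cap of mass of order \<open>(2 ^ m * r) powr E\<close>. The product is
  \<open>r powr (- c)\<close> times a power of \<open>2 powr (- c)\<close>, so \<open>c > 0\<close>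
  makes the series geometric.\<close>

lemma forelli_rudin:
  assumes t: "-1 < t" and c: "0 < c"
  shows "\<exists>C\<ge>0. \<forall>a :: complex ^ 'n. norm a < 1 \<longrightarrow>
    (\<integral>\<^sup>+z. ennreal ((1 - (norm z)\<^sup>2) powr t / norm (1 - cinner z a) powr (real CARD('n) + 1 + t + c)) * indicator (ball 0 1) z \<partial>lborel)
      \<le> ennreal (C * (1 - (norm a)\<^sup>2) powr (- c))"
proof -
  define E where "E = real CARD('n) + 1 + t"
  have E: "E > 0" using t unfolding E_def by simp
  obtain C where C0: "C \<ge> 0" and C: "\<forall>(\<zeta> :: complex ^ 'n) \<delta>. norm \<zeta> = 1 \<longrightarrow> 0 < \<delta> \<longrightarrow>
    (\<integral>\<^sup>+z. ennreal ((1 - (norm z)\<^sup>2) powr t) * indicator {z. norm z < 1 \<and> norm (1 - cinner z \<zeta>) < \<delta>} z \<partial>lborel)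
      \<le> ennreal (C * \<delta> powr E)"
    using weighted_volume_cap[OF t, where 'n='n] unfolding E_def[symmetric] by (elim exE conjE) (rule that)
  define q where "q = 2 powr (- c)"
  have q: "0 < q" "q < 1" using c by (auto simp: q_def powr_less_one)
  define D where "D = C * 4 powr E * (1 / (1 - q))"
  have D: "D \<ge> 0" using C0 q by (simp add: D_def)
  show ?thesis unfolding E_def[symmetric]
  proof (rule exI[of _ "D * 2 powr c"], intro conjI allI impI)
    show "0 \<le> D * 2 powr c" using D by simp
    fix a :: "complex ^ 'n" assume a: "norm a < 1"
    define r where "r = 1 - norm a"
    have r: "r > 0" using a by (simp add: r_def)
    obtain \<zeta> where \<zeta>: "norm \<zeta> = 1" "norm (\<zeta> - a) = r"
      using exists_radial_projection[OF a] unfolding r_def by blast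
    define X where "X m = {z. norm z < 1 \<and> norm (1 - cinner z \<zeta>) < 4 * 2 ^ m * r}" for m :: nat
    have Xm [measurable]: "X m \<in> sets borel" for m
    proof -
      have "open (X m)" unfolding X_def
        by (intro open_Collect_conj open_Collect_less continuous_intros)
      then show ?thesis by simp
    qed
    define W where "W z = (1 - (norm z)\<^sup>2) powr t" for z :: "complex ^ 'n"
    have Wm [measurable]: "W \<in> borel_measurable borel" unfolding W_def by measurable
    have W0: "0 \<le> W z" for z by (simp add: W_def)
    have "(\<integral>\<^sup>+z. ennreal (W z / norm (1 - cinner z a) powr (E + c)) * indicator (ball 0 1) z \<partial>lborel)
      \<le> (\<integral>\<^sup>+z. (\<Sum>m. ennreal ((2 ^ m * r) powr (- (E + c))) * (ennreal (W z) * indicator (X m) z)) \<partial>lborel)"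
    proof (intro nn_integral_mono)
      fix z :: "complex ^ 'n"
      show "ennreal (W z / norm (1 - cinner z a) powr (E + c)) * indicator (ball 0 1) z
        \<le> (\<Sum>m. ennreal ((2 ^ m * r) powr (- (E + c))) * (ennreal (W z) * indicator (X m) z))"
      proof (cases "norm z < 1")
        case True
        let ?d = "norm (1 - cinner z a)"
        have rd: "r \<le> ?d" unfolding r_def using True a by (intro one_minus_norm_le) auto
        obtain m where m: "2 ^ m * r \<le> ?d" "?d < 2 ^ Suc m * r" using exists_dyadic_scale[OF r rd] .
        \<comment> \<open>Replacing \<open>a\<close> by its radial projection costs at most
          \<open>r\<close>, hence at most a second copy of \<open>|1 - <z, a>|\<close>; together
          with the dyadic factor two this gives the 4 in the caps.\<close>
        have "1 - cinner z \<zeta> = (1 - cinner z a) - cinner z (\<zeta> - a)" by (simp add: cinner_diff_right)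
        then have "norm (1 - cinner z \<zeta>) \<le> ?d + norm (cinner z (\<zeta> - a))"
          using norm_triangle_ineq4 by metis
        also have "norm (cinner z (\<zeta> - a)) \<le> 1 * r"
          using norm_cinner_le[of z "\<zeta> - a"] True \<zeta>(2) r
          by (metis less_imp_le mult_right_mono order_trans)
        finally have "norm (1 - cinner z \<zeta>) \<le> ?d + r" by simp
        then have "norm (1 - cinner z \<zeta>) < 4 * 2 ^ m * r" using rd m by simp
        then have zX: "z \<in> X m" using True by (simp add: X_def)
        have "?d powr (- (E + c)) \<le> (2 ^ m * r) powr (- (E + c))"
          using m r E c by (intro powr_mono2') auto
        then have "W z / ?d powr (E + c) \<le> (2 ^ m * r) powr (- (E + c)) * W z"
          using mult_right_mono[OF _ W0[of z]] unfolding powr_minus[of ?d] divide_inverse by (metis mult.commute)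
        then have "ennreal (W z / ?d powr (E + c)) \<le> ennreal ((2 ^ m * r) powr (- (E + c)) * W z)"
          by (rule ennreal_leI)
        also have "\<dots> = ennreal ((2 ^ m * r) powr (- (E + c))) * (ennreal (W z) * indicator (X m) z)"
          using zX by (simp add: ennreal_mult')
        also have "\<dots> \<le> (\<Sum>m. ennreal ((2 ^ m * r) powr (- (E + c))) * (ennreal (W z) * indicator (X m) z))"
          by (rule le_suminf_ennreal)
        finally show ?thesis using True by simp
      qed simp
    qed
    also have "\<dots> = (\<Sum>m. \<integral>\<^sup>+z. ennreal ((2 ^ m * r) powr (- (E + c))) * (ennreal (W z) * indicator (X m) z) \<partial>lborel)"
      by (rule nn_integral_suminf) measurable
    also have "\<dots> = (\<Sum>m. ennreal ((2 ^ m * r) powr (- (E + c))) * (\<integral>\<^sup>+z. ennreal (W z) * indicator (X m) z \<partial>lborel))"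
      by (intro arg_cong[where f=suminf] ext nn_integral_cmult) measurable
    also have "\<dots> \<le> (\<Sum>m. ennreal ((2 ^ m * r) powr (- (E + c))) * ennreal (C * (4 * 2 ^ m * r) powr E))"
    proof (intro suminf_le mult_left_mono)
      show "(\<integral>\<^sup>+z. ennreal (W z) * indicator (X m) z \<partial>lborel) \<le> ennreal (C * (4 * 2 ^ m * r) powr E)" for m
        unfolding W_def X_def using r by (intro C[rule_format] \<zeta>) simp
    qed auto
    also have "\<dots> = (\<Sum>m. ennreal (C * 4 powr E * r powr (- c)) * ennreal (q ^ m))"
    proof (intro arg_cong[where f=suminf] ext)
      fix m :: nat
      have "(2 ^ m * r) powr (- (E + c)) * (C * (4 * 2 ^ m * r) powr E)
         = C * 4 powr E * ((2 ^ m * r) powr (- (E + c)) * (2 ^ m * r) powr E)"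
        using r by (simp add: powr_mult)
      also have "(2 ^ m * r) powr (- (E + c)) * (2 ^ m * r) powr E = (2 ^ m * r) powr (- c)"
        by (simp add: powr_add[symmetric])
      also have "\<dots> = r powr (- c) * q ^ m"
      proof -
        have "(2 ^ m) powr (- c) = q ^ m" unfolding q_def
          by (induction m) (auto simp: powr_mult)
        then show ?thesis using r by (simp add: powr_mult)
      qed
      finally have "(2 ^ m * r) powr (- (E + c)) * (C * (4 * 2 ^ m * r) powr E) = C * 4 powr E * r powr (- c) * q ^ m"
        by (simp only: mult.assoc)
      moreover have "ennreal ((2 ^ m * r) powr (- (E + c))) * ennreal (C * (4 * 2 ^ m * r) powr E)
         = ennreal ((2 ^ m * r) powr (- (E + c)) * (C * (4 * 2 ^ m * r) powr E))"
        by (rule ennreal_mult'[symmetric]) simp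
      moreover have "ennreal (C * 4 powr E * r powr (- c)) * ennreal (q ^ m) = ennreal (C * 4 powr E * r powr (- c) * q ^ m)"
        using C0 by (intro ennreal_mult'[symmetric]) simp
      ultimately show "ennreal ((2 ^ m * r) powr (- (E + c))) * ennreal (C * (4 * 2 ^ m * r) powr E)
         = ennreal (C * 4 powr E * r powr (- c)) * ennreal (q ^ m)" by presburger
    qed
    also have "\<dots> = ennreal (C * 4 powr E * r powr (- c)) * ennreal (1 / (1 - q))"
    proof -
      have "(\<Sum>m. ennreal (q ^ m)) = ennreal (1 / (1 - q))"
        using q by (subst suminf_ennreal2) (auto simp: suminf_geometric)
      then show ?thesis by simp
    qed
    also have "\<dots> = ennreal (D * r powr (- c))"
      using C0 q unfolding D_def by (subst ennreal_mult[symmetric]) (auto simp: mult_ac)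
    \<comment> \<open>The defect \<open>1 - |a|^2\<close> is at most \<open>2 * r\<close>; the
      negative exponent reverses this and accounts for \<open>2 powr c\<close>.\<close>
    also have "\<dots> \<le> ennreal (D * (2 powr c * (1 - (norm a)\<^sup>2) powr (- c)))"
    proof (intro ennreal_leI mult_left_mono D)
      have p: "0 < 1 - (norm a)\<^sup>2" using a by (simp add: abs_square_less_1)
      have "1 - (norm a)\<^sup>2 = r * (1 + norm a)" by (simp add: r_def power2_eq_square algebra_simps)
      also have "\<dots> \<le> r * 2" using r a by (intro mult_left_mono) auto
      finally have "(r * 2) powr (- c) \<le> (1 - (norm a)\<^sup>2) powr (- c)" using p c by (intro powr_mono2') auto
      then have "2 powr c * ((r * 2) powr (- c)) \<le> 2 powr c * (1 - (norm a)\<^sup>2) powr (- c)"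
        by (intro mult_left_mono) auto
      moreover have "2 powr c * ((r * 2) powr (- c)) = r powr (- c)"
        using r by (simp add: powr_mult powr_minus)
      ultimately show "r powr (- c) \<le> 2 powr c * (1 - (norm a)\<^sup>2) powr (- c)" by simp
    qed
    finally show "(\<integral>\<^sup>+z. ennreal ((1 - (norm z)\<^sup>2) powr t / norm (1 - cinner z a) powr (E + c)) * indicator (ball 0 1) z \<partial>lborel)
      \<le> ennreal (D * 2 powr c * (1 - (norm a)\<^sup>2) powr (- c))" unfolding W_def by (simp only: mult.assoc)
  qed
qed

section \<open>Volume of the neighbourhoods\<close>

text \<open>The coordinates other than \<open>i\<close> may move freely by order
  \<open>sqrt l\<close>; coordinate \<open>i\<close> then has a disc of radius of order
  \<open>l\<close> around the point where \<open><w - a, a>\<close> vanishes. The areas multiply to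
  \<open>l^2 * l ^ (n - 1)\<close>.\<close>

lemma emeasure_nbhd_ge:
  "\<exists>c>0. \<forall>a :: complex ^ 'n. norm a < 1 \<longrightarrow>
    ennreal (c * (1 - (norm a)\<^sup>2) powr (real CARD('n) + 1)) \<le> emeasure lborel (nbhd a)"
proof -
  define n where "n = real CARD('n)"
  have n: "n \<ge> 1" unfolding n_def using finite_UNIV_card_ge_0[where 'a='n] by auto
  \<comment> \<open>Each coordinate of the displacement is at most
    \<open>(n + 1) * e * sqrt l\<close>, so its squared norm is at most
    \<open>((n + 1)^2 * e)^2 * l\<close>, which this choice makes \<open>l / 16\<close>. The
    condition along \<open>a\<close> needs only \<open>e \<le> 1 / 16\<close>.\<close>
  define e where "e = 1 / (4 * (n + 1)\<^sup>2)"
  have n4: "4 \<le> (n + 1)\<^sup>2" using power_mono[of 2 "n + 1" 2] n by simp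
  have e: "0 < e" "e \<le> 1 / 16" using n n4 by (auto simp: e_def field_simps)
  define v where "v = unit_ball_vol 2"
  have v: "v > 0" by (simp add: v_def)
  define c where "c = v * e\<^sup>2 * (v * e\<^sup>2) ^ (CARD('n) - 1)"
  show ?thesis
  proof (rule exI[of _ c], intro conjI allI impI)
    show "c > 0" using v e by (simp add: c_def)
    fix a :: "complex ^ 'n" assume a: "norm a < 1"
    define l where "l = 1 - (norm a)\<^sup>2"
    have l: "0 < l" "l \<le> 1" using a by (auto simp: l_def abs_square_less_1)
    have sl: "l \<le> sqrt l" using l by (intro real_le_rsqrt) (simp add: power2_eq_square mult_left_le)
    \<comment> \<open>With \<open>i\<close> a largest coordinate of \<open>a\<close>, the centre \<open>p\<close> of the slice below is controlled by the
      other coordinates; for \<open>a = 0\<close> division by zero gives \<open>p = 0\<close>, which is the right value.\<close>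
    obtain i where i: "\<And>j. norm (a $ j) \<le> norm (a $ i)" using exists_max_coordinate[of a] by metis
    have "ennreal (v * (e * l)\<^sup>2) * ennreal ((unit_ball_vol 2 * (e * sqrt l)\<^sup>2) ^ (CARD('n) - 1)) \<le> emeasure lborel (nbhd a)"
    proof (rule emeasure_coordinate_ge[where i=i and c="\<lambda>j. a $ j"])
      fix x assume x: "\<And>j. j \<noteq> i \<Longrightarrow> x j \<in> ball (a $ j) (e * sqrt l)"
      define s where "s = (\<Sum>j\<in>UNIV - {i}. (x j - a $ j) * cnj (a $ j))"
      define p where "p = - s / cnj (a $ i)"
      have xj: "norm (x j - a $ j) \<le> e * sqrt l" if "j \<noteq> i" for j
        using x[OF that] by (simp add: dist_norm norm_minus_commute)
      have "norm s \<le> (\<Sum>j\<in>UNIV - {i}. e * sqrt l * norm (a $ i))"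
        unfolding s_def
        by (intro sum_norm_le) (auto simp: norm_mult intro!: mult_mono xj i mult_nonneg_nonneg less_imp_le[OF e(1)] l(1)[THEN less_imp_le])
      also have "\<dots> \<le> n * (e * sqrt l * norm (a $ i))"
        unfolding n_def using e l by (simp add: card_Diff_singleton of_nat_diff algebra_simps)
      finally have "norm s \<le> n * (e * sqrt l) * norm (a $ i)" by (simp only: mult.assoc)
      then have p: "norm p \<le> n * (e * sqrt l)"
        using n e l by (cases "a $ i = 0") (auto simp: p_def norm_divide field_simps)
      have "ball (a $ i + p) (e * l) \<subseteq> {w. vec_lambda (x(i := w)) \<in> nbhd a}"
      proof
        fix w assume "w \<in> ball (a $ i + p) (e * l)"
        then have w: "norm (w - a $ i - p) < e * l" by (simp add: dist_norm norm_minus_commute algebra_simps)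
        let ?y = "vec_lambda (x(i := w)) - a"
        have cy: "cinner ?y a = (w - a $ i) * cnj (a $ i) + s"
          by (simp add: cinner_def s_def sum.remove[of UNIV i])
        have "cinner ?y a = (w - a $ i - p) * cnj (a $ i)"
        proof (cases "a $ i = 0")
          case True
          then have "a $ j = 0" for j using i[of j] by simp
          then show ?thesis by (simp add: cinner_def)
        next
          case False
          then show ?thesis unfolding cy p_def by (simp add: field_simps)
        qed
        then have "norm (cinner ?y a) = norm (w - a $ i - p) * norm (a $ i)" by (simp add: norm_mult)
        also have "\<dots> \<le> e * l * 1"
          using w Finite_Cartesian_Product.norm_nth_le[of a i] a e l by (intro mult_mono) auto
        also have "\<dots> \<le> l / 16" using mult_right_mono[OF e(2), of l] l by simp
        finally have 1: "norm (cinner ?y a) \<le> l / 16" .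
        have wi: "norm (w - a $ i) \<le> (n + 1) * (e * sqrt l)"
        proof -
          have "norm (w - a $ i) \<le> norm (w - a $ i - p) + norm p"
            using norm_triangle_ineq[of "w - a $ i - p" p] by simp
          also have "\<dots> \<le> e * sqrt l + n * (e * sqrt l)"
            using w p mult_left_mono[OF sl, of e] e by linarith
          finally show ?thesis by (simp add: algebra_simps)
        qed
        have yj: "norm (?y $ j) \<le> (n + 1) * (e * sqrt l)" for j
        proof (cases "j = i")
          case True
          then show ?thesis using wi by simp
        next
          case False
          have "e * sqrt l \<le> (n + 1) * (e * sqrt l)" using n e l by (simp add: mult_right_mono[of 1 "n + 1" "e * sqrt l", simplified])
          then show ?thesis using xj[OF False] False by simp
        qed
        have "(norm ?y)\<^sup>2 \<le> (\<Sum>j\<in>(UNIV :: 'n set). ((n + 1) * (e * sqrt l))\<^sup>2)"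
          unfolding norm_sq_vec by (intro sum_mono power_mono yj) auto
        also have "\<dots> = n * ((n + 1)\<^sup>2 * e\<^sup>2 * l)"
          using l by (simp add: n_def power_mult_distrib)
        also have "\<dots> \<le> (n + 1)\<^sup>2 * ((n + 1)\<^sup>2 * e\<^sup>2 * l)"
        proof (rule mult_right_mono)
          show "n \<le> (n + 1)\<^sup>2" using n by (simp add: power2_eq_square algebra_simps)
          show "0 \<le> (n + 1)\<^sup>2 * e\<^sup>2 * l" using l by simp
        qed
        also have "\<dots> = ((n + 1)\<^sup>2 * e)\<^sup>2 * l" by (simp add: power_mult_distrib power2_eq_square)
        also have "(n + 1)\<^sup>2 * e = 1 / 4" using n by (simp add: e_def)
        also have "(1 / 4)\<^sup>2 * l = l / 16" by (simp add: power2_eq_square)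
        finally have 2: "(norm ?y)\<^sup>2 \<le> l / 16" .
        show "w \<in> {w. vec_lambda (x(i := w)) \<in> nbhd a}"
          using 1 2 unfolding nbhd_def l_def mem_Collect_eq by (rule conjI[rotated])
      qed
      then have "(\<integral>\<^sup>+w. indicator (ball (a $ i + p) (e * l)) w \<partial>lborel) \<le> (\<integral>\<^sup>+w. indicator (nbhd a) (vec_lambda (x(i := w))) \<partial>lborel)"
        by (intro nn_integral_mono) (auto split: split_indicator)
      moreover have "(\<integral>\<^sup>+w. indicator (ball (a $ i + p) (e * l)) w \<partial>lborel) = ennreal (v * (e * l)\<^sup>2)"
      proof -
        have "(\<integral>\<^sup>+w. indicator (ball (a $ i + p) (e * l)) w \<partial>lborel) = emeasure lborel (ball (a $ i + p) (e * l))"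
          by (rule nn_integral_indicator) (simp add: borel_open)
        also have "\<dots> = ennreal (v * (e * l)\<^sup>2)" using e l by (subst emeasure_ball) (auto simp: v_def)
        finally show ?thesis .
      qed
      ultimately show "ennreal (v * (e * l)\<^sup>2) \<le> (\<integral>\<^sup>+w. indicator (nbhd a) (vec_lambda (x(i := w))) \<partial>lborel)" by simp
    qed (use e l in auto)
    moreover have "ennreal (v * (e * l)\<^sup>2) * ennreal ((unit_ball_vol 2 * (e * sqrt l)\<^sup>2) ^ (CARD('n) - 1))
       = ennreal (c * l powr (n + 1))"
    proof -
      have "ennreal (v * (e * l)\<^sup>2) * ennreal ((unit_ball_vol 2 * (e * sqrt l)\<^sup>2) ^ (CARD('n) - 1))
        = ennreal (v * (e * l)\<^sup>2 * (unit_ball_vol 2 * (e * sqrt l)\<^sup>2) ^ (CARD('n) - 1))"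
        using v by (intro ennreal_mult'[symmetric]) simp
      also have "v * (e * l)\<^sup>2 * (unit_ball_vol 2 * (e * sqrt l)\<^sup>2) ^ (CARD('n) - 1) = c * (l\<^sup>2 * l ^ (CARD('n) - 1))"
        using l by (simp add: c_def v_def power_mult_distrib)
      also have "l\<^sup>2 * l ^ (CARD('n) - 1) = l powr (n + 1)"
      proof -
        have "l\<^sup>2 * l ^ (CARD('n) - 1) = l ^ (CARD('n) + 1)"
          using n by (simp add: n_def power_add[symmetric])
        also have "\<dots> = l powr real (CARD('n) + 1)" by (rule powr_realpow[symmetric, OF l(1)])
        finally show ?thesis by (simp add: n_def add.commute)
      qed
      finally show ?thesis .
    qed
    ultimately show "ennreal (c * (1 - (norm a)\<^sup>2) powr (real CARD('n) + 1)) \<le> emeasure lborel (nbhd a)"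
      unfolding l_def n_def by simp
  qed
qed

section \<open>Sums of kernels over the sequence\<close>

lemma defect_pos: "norm (a :: complex ^ 'n) < 1 \<Longrightarrow> 0 < 1 - (norm a)\<^sup>2"
  by (simp add: abs_square_less_1)

lemma kernel_pos:
  fixes z a :: "complex ^ 'n"
  assumes "norm z \<le> 1" "norm a < 1"
  shows "0 < norm (1 - cinner z a)"
  using one_minus_norm_le[of z a] assms by linarith

lemma powr_comparable:
  fixes x y t :: real
  assumes "0 < x" "0 < y" "x \<le> 2 * y" "y \<le> 2 * x"
  shows "x powr t \<le> 2 powr \<bar>t\<bar> * y powr t"
proof (cases "t \<ge> 0")
  case True
  then have "x powr t \<le> (2 * y) powr t" using assms by (intro powr_mono2) auto
  then show ?thesis using True assms by (simp add: powr_mult)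
next
  case False
  then have "x powr t \<le> (y / 2) powr t" using assms by (intro powr_mono2') auto
  also have "\<dots> = 2 powr (- t) * y powr t" using assms by (simp add: powr_divide powr_minus field_simps)
  finally show ?thesis using False by simp
qed

lemma Kconst_row:
  assumes "Kconst a r s \<le> R"
  shows "(\<Sum>j. if j = k then 0 else
      ennreal ((1 - (norm (a k))\<^sup>2) powr r * (1 - (norm (a j))\<^sup>2) powr s
               / (norm (1 - cinner (a j) (a k))) powr (r + s))) \<le> R"
  using assms unfolding Kconst_def by (simp add: SUP_le_iff)

text \<open>If \<open>w\<close> lies in the neighbourhoods of \<open>a k\<close> and
  \<open>a j\<close>, then \<open>|1 - <a j, a k>|\<close> is at most 32 times either defect, so the
  j-th term in row \<open>k\<close> of \<open>K\<close> is at least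
  \<open>32 powr (- (r + s))\<close>. The row bound limits how many such \<open>j\<close> exist; the
  summand 1 counts \<open>j = k\<close>.\<close>

lemma nbhd_overlap:
  fixes a :: "nat \<Rightarrow> complex ^ 'n"
  assumes a: "\<And>j. norm (a j) < 1" and r: "0 < r" and s: "0 < s"
    and K: "Kconst a r s \<le> ennreal R" and R: "0 \<le> R"
  shows "(\<Sum>j. indicator (nbhd (a j)) w) \<le> ennreal (1 + 32 powr (r + s) * R)"
proof (cases "\<exists>k. w \<in> nbhd (a k)")
  case False
  then show ?thesis by simp
next
  case True
  then obtain k where k: "w \<in> nbhd (a k)" by blast
  define T where "T j = (if j = k then 0 else
      ennreal ((1 - (norm (a k))\<^sup>2) powr r * (1 - (norm (a j))\<^sup>2) powr s
               / (norm (1 - cinner (a j) (a k))) powr (r + s)))" for j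
  have le: "indicator (nbhd (a j)) w \<le> (if j = k then 1 else 0) + ennreal (32 powr (r + s)) * T j" for j
  proof (cases "j = k \<or> w \<notin> nbhd (a j)")
    case True
    then show ?thesis by (auto split: split_indicator)
  next
    case False
    then have j: "j \<noteq> k" "w \<in> nbhd (a j)" by auto
    let ?lk = "1 - (norm (a k))\<^sup>2" and ?lj = "1 - (norm (a j))\<^sup>2" and ?d = "norm (1 - cinner (a j) (a k))"
    have l: "0 < ?lk" "0 < ?lj" by (rule defect_pos[OF a])+
    have d: "0 < ?d" using a[of j] a[of k] by (intro kernel_pos) auto
    \<comment> \<open>The common point \<open>w\<close> is a stepping stone: the kernel is moved
      from \<open>a k\<close> to \<open>w\<close> and on to \<open>a j\<close>, where it equals the
      defect (factor 8), and comparing defects through \<open>w\<close> costs another 4.\<close>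
    have "?d \<le> 4 * norm (1 - cinner (a j) w)" using nbhd_kernel(2)[OF k a, of "a j"] a[of j] by simp
    also have "norm (1 - cinner (a j) w) \<le> 2 * norm (1 - cinner (a j) (a j))"
      using nbhd_kernel(1)[OF j(2) a, of "a j"] a[of j] by simp
    also have "norm (1 - cinner (a j) (a j)) = ?lj"
    proof -
      have "1 - cinner (a j) (a j) = complex_of_real ?lj" by (simp add: cinner_self)
      then show ?thesis using l by (simp only: norm_of_real abs_of_pos)
    qed
    finally have d1: "?d \<le> 8 * ?lj" by simp
    have "?lj \<le> 2 * (1 - (norm w)\<^sup>2)" by (rule nbhd_defect(2)[OF j(2) a])
    moreover have "1 - (norm w)\<^sup>2 \<le> 2 * ?lk" by (rule nbhd_defect(1)[OF k a])
    ultimately have d2: "?d \<le> 32 * ?lk" using d1 by argo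
    have d1': "?d \<le> 32 * ?lj" using d1 l by argo
    have "?d powr (r + s) = ?d powr r * ?d powr s" by (rule powr_add)
    also have "\<dots> \<le> (32 * ?lk) powr r * (32 * ?lj) powr s"
      using d d1' d2 r s by (intro mult_mono powr_mono2) auto
    also have "\<dots> = 32 powr (r + s) * (?lk powr r * ?lj powr s)"
    proof -
      have "(32 * x) powr r * (32 * y) powr s = 32 powr (r + s) * (x powr r * y powr s)" if "0 < x" "0 < y" for x y :: real
        using that by (simp add: powr_mult powr_add)
      from this[OF l] show ?thesis .
    qed
    finally have "1 \<le> 32 powr (r + s) * (?lk powr r * ?lj powr s / ?d powr (r + s))"
      using d by (subst times_divide_eq_right, subst le_divide_eq_1_pos) auto
    then have "ennreal 1 \<le> ennreal (32 powr (r + s) * (?lk powr r * ?lj powr s / ?d powr (r + s)))"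
      by (rule ennreal_leI)
    also have "\<dots> = ennreal (32 powr (r + s)) * T j"
      unfolding T_def using j(1) by (simp only: if_False) (rule ennreal_mult', simp)
    finally show ?thesis using j by simp
  qed
  have one: "(\<Sum>j. if j = k then 1 else 0) = (1::ennreal)"
    using suminf_finite[of "{k}" "\<lambda>j. if j = k then 1 else (0::ennreal)"] by simp
  have "(\<Sum>j. indicator (nbhd (a j)) w) \<le> (\<Sum>j. (if j = k then 1 else 0) + ennreal (32 powr (r + s)) * T j)"
    by (intro suminf_le le) auto
  also have "\<dots> = (\<Sum>j. if j = k then 1 else 0) + (\<Sum>j. ennreal (32 powr (r + s)) * T j)"
    by (rule suminf_add[symmetric]) auto
  also have "\<dots> = 1 + ennreal (32 powr (r + s)) * (\<Sum>j. T j)" unfolding one by simp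
  also have "\<dots> \<le> 1 + ennreal (32 powr (r + s)) * ennreal R"
    using Kconst_row[OF K, of k] unfolding T_def by (intro add_left_mono mult_left_mono) auto
  also have "\<dots> = ennreal (1 + 32 powr (r + s) * R)"
    using R by (simp add: ennreal_mult ennreal_plus)
  finally show ?thesis .
qed

text \<open>Each summand is at most a constant times the integral of the kernel over the
  neighbourhood of \<open>a j\<close>: the volume supplies the power \<open>n + 1\<close> of the
  defect, so the discrete exponent \<open>n + 1 + t\<close> matches the continuous weight
  \<open>t\<close>. Bounded overlap merges these integrals into one over the ball, with
  \<open>z\<close> now the fixed pole.\<close>

lemma kernel_sum_bound:
  fixes a :: "nat \<Rightarrow> complex ^ 'n"
  assumes a: "\<And>j. norm (a j) < 1" and M: "0 \<le> M" "\<And>w. (\<Sum>j. indicator (nbhd (a j)) w) \<le> ennreal M"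
    and t: "-1 < t" and c: "0 < c"
  shows "\<exists>C\<ge>0. \<forall>z. norm z < 1 \<longrightarrow>
    (\<Sum>j. ennreal ((1 - (norm (a j))\<^sup>2) powr (real CARD('n) + 1 + t) / norm (1 - cinner z (a j)) powr (real CARD('n) + 1 + t + c)))
      \<le> ennreal (C * (1 - (norm z)\<^sup>2) powr (- c))"
proof -
  define E where "E = real CARD('n) + 1 + t + c"
  have E: "E > 0" using t c unfolding E_def by simp
  obtain C where C0: "C \<ge> 0" and C: "\<forall>z :: complex ^ 'n. norm z < 1 \<longrightarrow>
    (\<integral>\<^sup>+w. ennreal ((1 - (norm w)\<^sup>2) powr t / norm (1 - cinner w z) powr E) * indicator (ball 0 1) w \<partial>lborel)
      \<le> ennreal (C * (1 - (norm z)\<^sup>2) powr (- c))"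
    using forelli_rudin[OF t c, where 'n='n] unfolding E_def[symmetric] by (elim exE conjE) (rule that)
  obtain v where v0: "v > 0" and v: "\<forall>a :: complex ^ 'n. norm a < 1 \<longrightarrow>
    ennreal (v * (1 - (norm a)\<^sup>2) powr (real CARD('n) + 1)) \<le> emeasure lborel (nbhd a)"
    using emeasure_nbhd_ge[where 'n='n] by (elim exE conjE) (rule that)
  \<comment> \<open>The factors are the losses from comparing defects, from comparing kernels, and
    from the lower volume bound, in this order.\<close>
  define K where "K = 2 powr \<bar>t\<bar> * 2 powr E / v"
  have K: "K > 0" using v0 by (simp add: K_def)
  show ?thesis unfolding E_def[symmetric]
  proof (rule exI[of _ "K * (M * C)"], intro conjI allI impI)
    show "0 \<le> K * (M * C)" using K M C0 by simp
    fix z :: "complex ^ 'n" assume z: "norm z < 1"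
    define g where "g w = (1 - (norm w)\<^sup>2) powr t / norm (1 - cinner w z) powr E" for w
    have [measurable]: "g \<in> borel_measurable borel" unfolding g_def by measurable
    have bm: "ball 0 1 \<in> sets (borel :: (complex ^ 'n) measure)" by (simp add: borel_open)
    have j: "ennreal ((1 - (norm (a j))\<^sup>2) powr (real CARD('n) + 1 + t) / norm (1 - cinner z (a j)) powr E)
       \<le> ennreal K * (\<integral>\<^sup>+w. ennreal (g w) * indicator (nbhd (a j)) w \<partial>lborel)" for j
    proof -
      let ?l = "1 - (norm (a j))\<^sup>2" and ?d = "norm (1 - cinner z (a j))"
      have l: "0 < ?l" by (rule defect_pos[OF a])
      have d: "0 < ?d" using z a by (intro kernel_pos) auto
      have pt: "?l powr t / ?d powr E / (2 powr \<bar>t\<bar> * 2 powr E) \<le> g w" if w: "w \<in> nbhd (a j)" for w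
      proof -
        note nw = nbhd_defect[OF w a]
        have lw: "0 < 1 - (norm w)\<^sup>2" by (rule defect_pos[OF nw(3)])
        have dw: "0 < norm (1 - cinner w z)" using nw(3) z by (intro kernel_pos) auto
        have "norm (1 - cinner w z) \<le> 2 * ?d"
          using nbhd_kernel(1)[OF w a, of z] z norm_one_minus_cinner_commute[of w z] by simp
        then have "norm (1 - cinner w z) powr E \<le> (2 * ?d) powr E" using E dw by (intro powr_mono2) auto
        then have 1: "norm (1 - cinner w z) powr E \<le> 2 powr E * ?d powr E" using d by (simp add: powr_mult)
        have 2: "?l powr t \<le> 2 powr \<bar>t\<bar> * (1 - (norm w)\<^sup>2) powr t"
          by (rule powr_comparable[OF l lw nw(2) nw(1)])
        have "?l powr t / ?d powr E / (2 powr \<bar>t\<bar> * 2 powr E) = (?l powr t / 2 powr \<bar>t\<bar>) / (2 powr E * ?d powr E)"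
          by (simp add: field_simps)
        also have "\<dots> \<le> (1 - (norm w)\<^sup>2) powr t / norm (1 - cinner w z) powr E"
          using 1 2 dw by (intro frac_le) (auto simp: field_simps)
        finally show ?thesis unfolding g_def .
      qed
      have nonneg: "0 \<le> ?l powr t / ?d powr E / (2 powr \<bar>t\<bar> * 2 powr E)" by simp
      have "ennreal (?l powr t / ?d powr E / (2 powr \<bar>t\<bar> * 2 powr E)) * ennreal (v * ?l powr (real CARD('n) + 1))
         \<le> ennreal (?l powr t / ?d powr E / (2 powr \<bar>t\<bar> * 2 powr E)) * emeasure lborel (nbhd (a j))"
        by (intro mult_left_mono v[rule_format] a) simp
      also have "\<dots> = (\<integral>\<^sup>+w. ennreal (?l powr t / ?d powr E / (2 powr \<bar>t\<bar> * 2 powr E)) * indicator (nbhd (a j)) w \<partial>lborel)"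
        by (rule nn_integral_cmult_indicator[symmetric]) simp
      also have "\<dots> \<le> (\<integral>\<^sup>+w. ennreal (g w) * indicator (nbhd (a j)) w \<partial>lborel)"
        using pt by (intro nn_integral_mono) (auto intro!: ennreal_leI split: split_indicator)
      finally have "ennreal K * (ennreal (?l powr t / ?d powr E / (2 powr \<bar>t\<bar> * 2 powr E)) * ennreal (v * ?l powr (real CARD('n) + 1)))
        \<le> ennreal K * (\<integral>\<^sup>+w. ennreal (g w) * indicator (nbhd (a j)) w \<partial>lborel)" by (rule mult_left_mono) simp
      moreover have "ennreal K * (ennreal (?l powr t / ?d powr E / (2 powr \<bar>t\<bar> * 2 powr E)) * ennreal (v * ?l powr (real CARD('n) + 1)))
         = ennreal (K * (?l powr t / ?d powr E / (2 powr \<bar>t\<bar> * 2 powr E) * (v * ?l powr (real CARD('n) + 1))))"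
        using K by (subst ennreal_mult'[OF nonneg, symmetric], subst ennreal_mult'[symmetric]) auto
      moreover have "K * (?l powr t / ?d powr E / (2 powr \<bar>t\<bar> * 2 powr E) * (v * ?l powr (real CARD('n) + 1)))
         = ?l powr (real CARD('n) + 1 + t) / ?d powr E"
      proof -
        have "?l powr (real CARD('n) + 1 + t) = ?l powr (real CARD('n) + 1) * ?l powr t" by (rule powr_add)
        moreover have "A * B / v * (x / y / (A * B) * (v * u)) = u * x / y" if "A > 0" "B > 0" for A B x y u :: real
          using that v0 by (simp add: field_simps)
        ultimately show ?thesis unfolding K_def by simp
      qed
      ultimately show ?thesis by simp
    qed
    have "(\<Sum>j. \<integral>\<^sup>+w. ennreal (g w) * indicator (nbhd (a j)) w \<partial>lborel)
       = (\<integral>\<^sup>+w. (\<Sum>j. ennreal (g w) * indicator (nbhd (a j)) w) \<partial>lborel)"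
      by (rule nn_integral_suminf[symmetric]) measurable
    also have "\<dots> \<le> (\<integral>\<^sup>+w. ennreal M * (ennreal (g w) * indicator (ball 0 1) w) \<partial>lborel)"
    proof (rule nn_integral_mono)
      fix w
      show "(\<Sum>j. ennreal (g w) * indicator (nbhd (a j)) w) \<le> ennreal M * (ennreal (g w) * indicator (ball 0 1) w)"
      proof (cases "norm w < 1")
        case True
        have "(\<Sum>j. ennreal (g w) * indicator (nbhd (a j)) w) = ennreal (g w) * (\<Sum>j. indicator (nbhd (a j)) w)"
          by (rule ennreal_suminf_cmult)
        also have "\<dots> \<le> ennreal (g w) * ennreal M" by (intro mult_left_mono M) simp
        finally show ?thesis using True by (simp add: mult.commute)
      next
        case False
        then have "w \<notin> nbhd (a j)" for j using nbhd_defect(3)[OF _ a] by blast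
        then show ?thesis by simp
      qed
    qed
    also have "\<dots> = ennreal M * (\<integral>\<^sup>+w. ennreal (g w) * indicator (ball 0 1) w \<partial>lborel)"
    proof (rule nn_integral_cmult)
      have "(\<lambda>w. ennreal (g w)) \<in> borel_measurable lborel" by measurable
      then show "(\<lambda>w. ennreal (g w) * indicator (ball 0 1) w) \<in> borel_measurable lborel"
        using bm by (intro borel_measurable_times_ennreal borel_measurable_indicator) auto
    qed
    also have "\<dots> \<le> ennreal M * ennreal (C * (1 - (norm z)\<^sup>2) powr (- c))"
      unfolding g_def by (intro mult_left_mono C[rule_format] z) simp
    finally have sum_le: "(\<Sum>j. \<integral>\<^sup>+w. ennreal (g w) * indicator (nbhd (a j)) w \<partial>lborel)
        \<le> ennreal M * ennreal (C * (1 - (norm z)\<^sup>2) powr (- c))" .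
    have "(\<Sum>j. ennreal ((1 - (norm (a j))\<^sup>2) powr (real CARD('n) + 1 + t) / norm (1 - cinner z (a j)) powr E))
      \<le> (\<Sum>j. ennreal K * (\<integral>\<^sup>+w. ennreal (g w) * indicator (nbhd (a j)) w \<partial>lborel))"
      by (intro suminf_le j) auto
    also have "\<dots> = ennreal K * (\<Sum>j. \<integral>\<^sup>+w. ennreal (g w) * indicator (nbhd (a j)) w \<partial>lborel)"
      by (rule ennreal_suminf_cmult)
    also have "\<dots> \<le> ennreal K * (ennreal M * ennreal (C * (1 - (norm z)\<^sup>2) powr (- c)))"
      by (rule mult_left_mono[OF sum_le]) simp
    also have "ennreal K * (ennreal M * ennreal (C * (1 - (norm z)\<^sup>2) powr (- c))) = ennreal (K * (M * C) * (1 - (norm z)\<^sup>2) powr (- c))"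
    proof -
      have "ennreal K * (ennreal M * ennreal y) = ennreal (K * (M * y))" if "0 \<le> y" for y
        using that K M by (simp add: ennreal_mult)
      from this[of "C * (1 - (norm z)\<^sup>2) powr (- c)"] show ?thesis using C0 by (simp only: mult.assoc mult_nonneg_nonneg powr_ge_zero)
    qed
    finally show "(\<Sum>j. ennreal ((1 - (norm (a j))\<^sup>2) powr (real CARD('n) + 1 + t) / norm (1 - cinner z (a j)) powr E))
      \<le> ennreal (K * (M * C) * (1 - (norm z)\<^sup>2) powr (- c))" .
  qed
qed

section \<open>Synthesis of functions from kernels\<close>

lemma bounded_linear_cinner: "bounded_linear (\<lambda>h. cinner h b)"
proof (rule bounded_linear_intro)
  show "cinner (x + y) b = cinner x b + cinner y b" for x y
    by (simp add: cinner_def sum.distrib algebra_simps)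
  show "cinner (r *\<^sub>R x) b = r *\<^sub>R cinner x b" for r x
    by (simp add: cinner_def scaleR_sum_right)
  show "norm (cinner x b) \<le> norm x * norm b" for x by (rule norm_cinner_le)
qed

lemma cinner_scale: "cinner (c *s x) b = c * cinner x b"
  by (simp add: cinner_def sum_distrib_left mult.assoc)

lemma one_minus_norm_le_left: "norm b \<le> 1 \<Longrightarrow> norm z \<le> 1 \<Longrightarrow> 1 - norm z \<le> norm (1 - cinner z b)"
  using one_minus_norm_le[of b z] norm_one_minus_cinner_commute[of b z] by simp

lemma one_minus_cinner_Re_pos:
  assumes "norm z < 1" "norm b < 1"
  shows "0 < Re (1 - cinner z b)"
proof -
  have "Re (cinner z b) \<le> norm (cinner z b)" by (rule complex_Re_le_cmod)
  also have "\<dots> \<le> norm z * norm b" by (rule norm_cinner_le)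
  also have "\<dots> \<le> norm z * 1" using assms by (intro mult_left_mono) auto
  finally show ?thesis using assms by simp
qed

lemma norm_kernel_powr: "norm ((1 - cinner z b) powr (- complex_of_real \<sigma>)) = norm (1 - cinner z b) powr (- \<sigma>)"
  by (subst norm_powr_real_powr') auto

text \<open>Inside the ball \<open>1 - <z, b>\<close> has positive real part and so avoids the
  branch cut; the principal power is differentiable there for non-integer exponents as well.\<close>

lemma kernel_has_derivative:
  assumes "norm z < 1" "norm b < 1"
  shows "((\<lambda>z. (1 - cinner z b) powr s) has_derivative
     (\<lambda>h. s * (1 - cinner z b) powr (s - 1) * (- cinner h b))) (at z)"
proof -
  have "1 - cinner z b \<notin> \<real>\<^sub>\<le>\<^sub>0"
    using one_minus_cinner_Re_pos[OF assms] by (auto simp: complex_nonpos_Reals_iff)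
  then have "((\<lambda>w. w powr s) has_field_derivative s * (1 - cinner z b) powr (s - 1)) (at (1 - cinner z b))"
    by (rule has_field_derivative_powr)
  then have 1: "((\<lambda>w. w powr s) has_derivative (\<lambda>h. s * (1 - cinner z b) powr (s - 1) * h)) (at (1 - cinner z b))"
    by (simp add: has_field_derivative_def)
  have "((\<lambda>z. 1 - cinner z b) has_derivative (\<lambda>h. 0 - cinner h b)) (at z)"
    by (intro has_derivative_diff has_derivative_const bounded_linear_imp_has_derivative bounded_linear_cinner)
  from has_derivative_compose[OF this 1] show ?thesis by simp
qed

text \<open>Away from the sphere the kernels and their derivatives are bounded independently of
  \<open>j\<close>, so absolute summability of the coefficients suffices for termwise
  differentiation; complex linearity of the derivative passes through the series.\<close>

lemma kernel_series:
  fixes a :: "nat \<Rightarrow> complex ^ 'n" and \<kappa> :: "nat \<Rightarrow> complex"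
  assumes a: "\<And>j. norm (a j) < 1" and \<sigma>: "0 < \<sigma>" and sm: "summable (\<lambda>j. norm (\<kappa> j))"
  shows "norm z < 1 \<Longrightarrow> summable (\<lambda>j. norm (\<kappa> j * (1 - cinner z (a j)) powr (- complex_of_real \<sigma>)))"
    and "holo_on (\<lambda>z. \<Sum>j. \<kappa> j * (1 - cinner z (a j)) powr (- complex_of_real \<sigma>)) (ball 0 1)"
proof -
  have bound: "norm (1 - cinner z (a j)) powr (- e) \<le> (1 - \<rho>) powr (- e)"
    if "norm z \<le> \<rho>" "\<rho> < 1" "0 < e" for z \<rho> e j
    using one_minus_norm_le_left[of "a j" z] a[of j] that by (intro powr_mono2') auto
  have sm1: "summable (\<lambda>j. norm (\<kappa> j * (1 - cinner z (a j)) powr (- complex_of_real \<sigma>)))" if z: "norm z < 1" for z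
  proof (rule summable_comparison_test'[where N=0])
    show "summable (\<lambda>j. norm (\<kappa> j) * (1 - norm z) powr (- \<sigma>))" by (rule summable_mult2[OF sm])
    show "norm (norm (\<kappa> j * (1 - cinner z (a j)) powr (- complex_of_real \<sigma>))) \<le> norm (\<kappa> j) * (1 - norm z) powr (- \<sigma>)" for j
      using bound[of z "norm z" \<sigma> j] z \<sigma> by (simp add: norm_mult norm_kernel_powr mult_left_mono)
  qed
  show "norm z < 1 \<Longrightarrow> summable (\<lambda>j. norm (\<kappa> j * (1 - cinner z (a j)) powr (- complex_of_real \<sigma>)))"
    by (rule sm1)
  let ?f = "\<lambda>z. \<Sum>j. \<kappa> j * (1 - cinner z (a j)) powr (- complex_of_real \<sigma>)"
  show "holo_on ?f (ball 0 1)"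
    unfolding holo_on_def
  proof (intro ballI)
    fix z0 :: "complex ^ 'n" assume "z0 \<in> ball 0 1"
    then have z0: "norm z0 < 1" by simp
    \<comment> \<open>Bounds are uniform only on smaller balls; differentiability is local, so a
      ball containing \<open>z0\<close> is enough.\<close>
    obtain \<rho> where \<rho>: "norm z0 < \<rho>" "\<rho> < 1" using dense[OF z0] by blast
    define S where "S = ball (0 :: complex ^ 'n) \<rho>"
    define f' where "f' j x h = \<kappa> j * (- complex_of_real \<sigma> * (1 - cinner x (a j)) powr (- complex_of_real \<sigma> - 1) * (- cinner h (a j)))" for j x h
    define g' where "g' x h = (\<Sum>j. f' j x h)" for x h
    define m where "m j = norm (\<kappa> j) * (\<sigma> * (1 - \<rho>) powr (- (\<sigma> + 1)))" for j
    have m: "summable m" unfolding m_def by (rule summable_mult2[OF sm])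
    have m0: "0 \<le> m j" for j using \<sigma> by (simp add: m_def)
    have f'm: "norm (f' j x h) \<le> m j * norm h" if "x \<in> S" for j x h
    proof -
      have "norm ((1 - cinner x (a j)) powr (- complex_of_real \<sigma> - 1)) = norm (1 - cinner x (a j)) powr (- (\<sigma> + 1))"
        using norm_kernel_powr[of x "a j" "\<sigma> + 1"] by simp
      also have "\<dots> \<le> (1 - \<rho>) powr (- (\<sigma> + 1))" using that \<rho> \<sigma> by (intro bound) (auto simp: S_def)
      finally have 1: "norm ((1 - cinner x (a j)) powr (- complex_of_real \<sigma> - 1)) \<le> (1 - \<rho>) powr (- (\<sigma> + 1))" .
      have 2: "norm (cinner h (a j)) \<le> norm h"
        using norm_cinner_le[of h "a j"] mult_left_mono[of "norm (a j)" 1 "norm h"] a[of j] by simp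
      have "norm (f' j x h) = norm (\<kappa> j) * (\<sigma> * norm ((1 - cinner x (a j)) powr (- complex_of_real \<sigma> - 1)) * norm (cinner h (a j)))"
        using \<sigma> by (simp add: f'_def norm_mult)
      also have "\<dots> \<le> norm (\<kappa> j) * (\<sigma> * (1 - \<rho>) powr (- (\<sigma> + 1)) * norm h)"
        using \<sigma> by (intro mult_left_mono mult_mono 1 2) auto
      finally show ?thesis by (simp add: m_def)
    qed
    have sf': "summable (\<lambda>j. norm (f' j x h))" if "x \<in> S" for x h
      by (rule summable_comparison_test'[OF summable_mult2[OF m, of "norm h"], of 0]) (use f'm[OF that] in simp)
    have ex: "\<exists>g. \<forall>x\<in>S. (\<lambda>j. \<kappa> j * (1 - cinner x (a j)) powr (- complex_of_real \<sigma>)) sums g x \<and> (g has_derivative g' x) (at x within S)"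
    proof (rule has_derivative_series)
      show "convex S" by (simp add: S_def)
      show "((\<lambda>x. \<kappa> j * (1 - cinner x (a j)) powr (- complex_of_real \<sigma>)) has_derivative f' j x) (at x within S)" if "x \<in> S" for j x
        unfolding f'_def using that \<rho>
        by (intro has_derivative_mult_right has_derivative_at_withinI[OF kernel_has_derivative] a) (auto simp: S_def)
      show "z0 \<in> S" using \<rho> by (simp add: S_def)
      show "(\<lambda>j. \<kappa> j * (1 - cinner z0 (a j)) powr (- complex_of_real \<sigma>)) sums ?f z0"
        by (intro summable_sums summable_norm_cancel[OF sm1[OF z0]])
      show "\<forall>\<^sub>F k in sequentially. \<forall>x\<in>S. \<forall>h. norm ((\<Sum>j<k. f' j x h) - g' x h) \<le> e * norm h" if e: "0 < e" for e
      proof -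
        \<comment> \<open>One tail of the majorant \<open>m\<close> serves all points of
          \<open>S\<close> and, after scaling by \<open>norm h\<close>, all directions.\<close>
        obtain N where N: "\<And>k. k \<ge> N \<Longrightarrow> norm (\<Sum>i. m (i + k)) < e" using suminf_exist_split[OF e m] by blast
        have "norm ((\<Sum>j<k. f' j x h) - g' x h) \<le> e * norm h" if k: "k \<ge> N" and x: "x \<in> S" for k x h
        proof -
          have "g' x h = (\<Sum>i. f' (i + k) x h) + (\<Sum>j<k. f' j x h)"
            unfolding g'_def by (rule suminf_split_initial_segment[OF summable_norm_cancel[OF sf'[OF x]]])
          then have "norm ((\<Sum>j<k. f' j x h) - g' x h) = norm (\<Sum>i. f' (i + k) x h)"
            by (simp add: norm_minus_commute)
          also have "\<dots> \<le> (\<Sum>i. norm (f' (i + k) x h))"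
            by (intro summable_norm) (use sf'[OF x] in \<open>simp add: summable_iff_shift[of "\<lambda>i. norm (f' i x h)" k]\<close>)
          also have "\<dots> \<le> (\<Sum>i. m (i + k) * norm h)"
            by (intro suminf_le f'm x summable_mult2)
               (use sf'[OF x] m in \<open>simp_all add: summable_iff_shift[of m k] summable_iff_shift[of "\<lambda>i. norm (f' i x h)" k]\<close>)
          also have "\<dots> = (\<Sum>i. m (i + k)) * norm h"
            using m by (intro suminf_mult2[symmetric]) (simp add: summable_iff_shift[of m k])
          also have "\<dots> \<le> e * norm h" using N[OF k] by (intro mult_right_mono) auto
          finally show ?thesis .
        qed
        then show ?thesis unfolding eventually_sequentially by blast
      qed
    qed
    then obtain g where g: "\<And>x. x \<in> S \<Longrightarrow> (\<lambda>j. \<kappa> j * (1 - cinner x (a j)) powr (- complex_of_real \<sigma>)) sums g x"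
      "\<And>x. x \<in> S \<Longrightarrow> (g has_derivative g' x) (at x within S)" by blast
    have S: "open S" "z0 \<in> S" using \<rho> by (auto simp: S_def)
    have "(g has_derivative g' z0) (at z0)" using g(2)[OF S(2)] unfolding at_within_open[OF S(2,1)] .
    then have "(?f has_derivative g' z0) (at z0)"
      by (rule has_derivative_transform_within_open[OF _ S]) (rule sums_unique[OF g(1)])
    moreover have "g' z0 (c *s h) = c * g' z0 h" for c h
    proof -
      have "f' j z0 (c *s h) = c * f' j z0 h" for j by (simp add: f'_def cinner_scale)
      then show ?thesis unfolding g'_def
        using suminf_mult[OF summable_norm_cancel[OF sf'[OF S(2)]], of c h] by simp
    qed
    ultimately show "\<exists>L. (?f has_derivative L) (at z0) \<and> (\<forall>c x. L (c *s x) = c * L x)" by blast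
  qed
qed

text \<open>Schur's test from counting measure to the weighted volume: rows are kernel sums over the
  sequence, columns are Forelli-Rudin integrals.\<close>

lemma kernel_synthesis_Bp:
  fixes a :: "nat \<Rightarrow> complex ^ 'n" and x :: "nat \<Rightarrow> real"
  assumes p: "1 < p" and \<alpha>: "\<alpha> * p > - 1"
    and a: "\<And>j. norm (a j) < 1"
    and M: "0 \<le> M" "\<And>w. (\<Sum>j. indicator (nbhd (a j)) w) \<le> ennreal M"
    and \<sigma>: "\<sigma> = real CARD('n) + 1 + \<alpha> * p" and s: "s = \<sigma> - \<sigma> / p"
    and x: "\<And>j. 0 \<le> x j" "(\<Sum>j. ennreal (x j powr p)) < \<infinity>"
    and sm: "\<And>z. norm z < 1 \<Longrightarrow> summable (\<lambda>j. (1 - (norm (a j))\<^sup>2) powr s * norm (1 - cinner z (a j)) powr (- \<sigma>) * x j)"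
  shows "(\<integral>\<^sup>+z. ennreal ((1 - (norm z)\<^sup>2) powr (\<alpha> * p) *
      (\<Sum>j. (1 - (norm (a j))\<^sup>2) powr s * norm (1 - cinner z (a j)) powr (- \<sigma>) * x j) powr p) * indicator (ball 0 1) z \<partial>lborel) < \<infinity>"
proof -
  define l where "l z = 1 - (norm z)\<^sup>2" for z :: "complex ^ 'n"
  have l: "0 < l (a j)" for j unfolding l_def by (rule defect_pos[OF a])
  have lm [measurable]: "l \<in> borel_measurable borel" unfolding l_def by measurable
  \<comment> \<open>The unweighted Schur test (\<open>h = 1\<close>) can fail when \<open>r \<le> n\<close> or \<open>s \<le> n\<close>; perturbing the exponents by a small \<open>\<epsilon>\<close>
    brings both the sum and the integral into the Forelli--Rudin range.\<close>
  define \<epsilon> where "\<epsilon> = (1 + \<alpha> * p) / (2 * p)"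
  have \<epsilon>: "\<epsilon> > 0" using \<alpha> p by (simp add: \<epsilon>_def)
  \<comment> \<open>Since \<open>\<epsilon> * p\<close> is half of \<open>1 + \<alpha> * p\<close>,
    both \<open>\<epsilon>\<close> and \<open>\<epsilon> * (p - 1)\<close> stay below
    \<open>1 + \<alpha> * p\<close>, which keeps both weight exponents above -1.\<close>
  have \<epsilon>p: "\<epsilon> * p = (1 + \<alpha> * p) / 2" using p by (simp add: \<epsilon>_def)
  have "\<epsilon> \<le> \<epsilon> * p" using \<epsilon> p by simp
  then have \<epsilon>1: "\<epsilon> < 1 + \<alpha> * p" using \<epsilon>p \<alpha> by simp
  have \<epsilon>2: "\<epsilon> * (p - 1) < 1 + \<alpha> * p" using \<epsilon>p \<alpha> \<epsilon> by (simp add: right_diff_distrib)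
  have \<epsilon>3: "0 < \<epsilon> * (p - 1)" using \<epsilon> p by simp
  have t1: "-1 < \<alpha> * p - \<epsilon>" and t2: "-1 < \<alpha> * p - \<epsilon> * (p - 1)" using \<epsilon>1 \<epsilon>2 by linarith+
  have s1: "real CARD('n) + 1 + (\<alpha> * p - \<epsilon>) = \<sigma> - \<epsilon>" "\<sigma> - \<epsilon> + \<epsilon> = \<sigma>"
    and s2: "real CARD('n) + 1 + (\<alpha> * p - \<epsilon> * (p - 1)) + \<epsilon> * (p - 1) = \<sigma>" unfolding \<sigma> by simp_all
  obtain C1 where C10: "C1 \<ge> 0" and C1: "\<forall>z. norm z < 1 \<longrightarrow>
    (\<Sum>j. ennreal ((1 - (norm (a j))\<^sup>2) powr (\<sigma> - \<epsilon>) / norm (1 - cinner z (a j)) powr \<sigma>))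
      \<le> ennreal (C1 * (1 - (norm z)\<^sup>2) powr (- \<epsilon>))"
    using kernel_sum_bound[OF a M t1 \<epsilon>] unfolding s1 by (elim exE conjE) (rule that)
  obtain C2 where C20: "C2 \<ge> 0" and C2: "\<forall>b :: complex ^ 'n. norm b < 1 \<longrightarrow>
    (\<integral>\<^sup>+z. ennreal ((1 - (norm z)\<^sup>2) powr (\<alpha> * p - \<epsilon> * (p - 1)) / norm (1 - cinner z b) powr \<sigma>) * indicator (ball 0 1) z \<partial>lborel)
      \<le> ennreal (C2 * (1 - (norm b)\<^sup>2) powr (- (\<epsilon> * (p - 1))))"
    using forelli_rudin[OF t2 \<epsilon>3, where 'n='n] unfolding s2 by (elim exE conjE) (rule that)
  define Mu where "Mu = density lborel (\<lambda>z. ennreal (l z powr (\<alpha> * p)))"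
  \<comment> \<open>The indicator lets the test run over the whole space: outside the ball every row
    vanishes.\<close>
  define N where "N z j = indicator (ball 0 1) z * (l (a j) powr s * norm (1 - cinner z (a j)) powr (- \<sigma>))" for z j
  \<comment> \<open>The exponent is forced twice:
    \<open>s + (\<sigma> / p - \<epsilon>) = \<sigma> - \<epsilon>\<close> fits the row estimate,
    and \<open>s - \<epsilon> * (p - 1) = (\<sigma> / p - \<epsilon>) * (p - 1)\<close> makes the
    column integral reproduce \<open>h powr (p - 1)\<close>.\<close>
  define h where "h j = l (a j) powr (\<sigma> / p - \<epsilon>)" for j
  define G where "G z = C1 * l z powr (- \<epsilon>)" for z
  have bm: "ball 0 1 \<in> sets (borel :: (complex ^ 'n) measure)" by (simp add: borel_open)
  have Nm [measurable]: "(\<lambda>z. N z j) \<in> borel_measurable borel" for j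
  proof -
    have "(\<lambda>z. l (a j) powr s * norm (1 - cinner z (a j)) powr (- \<sigma>)) \<in> borel_measurable borel" by measurable
    from borel_measurable_times[OF borel_measurable_indicator[OF bm] this] show ?thesis unfolding N_def .
  qed
  have Gm [measurable]: "G \<in> borel_measurable borel" unfolding G_def by measurable
  have N0: "0 \<le> N z j" for z j unfolding N_def by simp
  have "(\<integral>\<^sup>+z. ennreal ((\<Sum>j. N z j * x j) powr p) \<partial>Mu) \<le> ennreal (C1 powr (p - 1) * C2) * (\<Sum>j. ennreal (x j powr p))"
  proof (rule schur_test[where h=h and G=G])
    show "(\<lambda>z. N z j) \<in> borel_measurable Mu" for j unfolding Mu_def by simp
    show "G \<in> borel_measurable Mu" unfolding Mu_def by simp
    show "(\<Sum>j. ennreal (N z j * h j)) \<le> ennreal (G z)" for z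
    proof (cases "norm z < 1")
      case True
      have e: "N z j * h j = (1 - (norm (a j))\<^sup>2) powr (\<sigma> - \<epsilon>) / norm (1 - cinner z (a j)) powr \<sigma>" for j
      proof -
        have "l (a j) powr s * h j = l (a j) powr (\<sigma> - \<epsilon>)"
          unfolding h_def s by (simp add: powr_add[symmetric])
        then have "N z j * h j = l (a j) powr (\<sigma> - \<epsilon>) * norm (1 - cinner z (a j)) powr (- \<sigma>)"
          unfolding N_def using True by (simp add: mult_ac)
        then show ?thesis unfolding l_def by (simp add: powr_minus_divide)
      qed
      show ?thesis unfolding e G_def l_def by (rule C1[rule_format, OF True])
    next
      case False
      then show ?thesis by (simp add: N_def)
    qed
    show "(\<integral>\<^sup>+z. ennreal (N z j * G z powr (p - 1)) \<partial>Mu) \<le> ennreal (C1 powr (p - 1) * C2 * h j powr (p - 1))" for j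
    proof -
      define B where "B = l (a j) powr s * C1 powr (p - 1)"
      have B0: "0 \<le> B" by (simp add: B_def)
      define k where "k z = (1 - (norm z)\<^sup>2) powr (\<alpha> * p - \<epsilon> * (p - 1)) / norm (1 - cinner z (a j)) powr \<sigma>" for z
      have km: "k \<in> borel_measurable borel" unfolding k_def by measurable
      have "(\<integral>\<^sup>+z. ennreal (N z j * G z powr (p - 1)) \<partial>Mu)
         = (\<integral>\<^sup>+z. ennreal (l z powr (\<alpha> * p)) * ennreal (N z j * G z powr (p - 1)) \<partial>lborel)"
        unfolding Mu_def by (rule nn_integral_density) measurable
      also have "\<dots> = (\<integral>\<^sup>+z. ennreal B * (ennreal (k z) * indicator (ball 0 1) z) \<partial>lborel)"
      proof (rule nn_integral_cong)
        fix z
        show "ennreal (l z powr (\<alpha> * p)) * ennreal (N z j * G z powr (p - 1)) = ennreal B * (ennreal (k z) * indicator (ball 0 1) z)"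
        proof (cases "norm z < 1")
          case True
          have lz: "0 < l z" unfolding l_def by (rule defect_pos[OF True])
          have "G z powr (p - 1) = C1 powr (p - 1) * l z powr (- (\<epsilon> * (p - 1)))"
            unfolding G_def using C10 lz by (simp add: powr_mult powr_powr)
          then have "l z powr (\<alpha> * p) * (N z j * G z powr (p - 1))
            = B * ((l z powr (\<alpha> * p) * l z powr (- (\<epsilon> * (p - 1)))) * norm (1 - cinner z (a j)) powr (- \<sigma>))"
            unfolding N_def B_def using True by (simp add: mult_ac)
          also have "l z powr (\<alpha> * p) * l z powr (- (\<epsilon> * (p - 1))) = l z powr (\<alpha> * p - \<epsilon> * (p - 1))"
            by (simp add: powr_add[symmetric])
          also have "l z powr (\<alpha> * p - \<epsilon> * (p - 1)) * norm (1 - cinner z (a j)) powr (- \<sigma>) = k z"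
            unfolding k_def l_def by (simp add: powr_minus_divide)
          finally have "l z powr (\<alpha> * p) * (N z j * G z powr (p - 1)) = B * k z" .
          moreover have "ennreal (l z powr (\<alpha> * p)) * ennreal (N z j * G z powr (p - 1)) = ennreal (l z powr (\<alpha> * p) * (N z j * G z powr (p - 1)))"
            by (rule ennreal_mult'[symmetric]) simp
          moreover have "ennreal B * ennreal (k z) = ennreal (B * k z)" by (rule ennreal_mult'[symmetric, OF B0])
          ultimately show ?thesis using True by simp
        next
          case False
          then show ?thesis by (simp add: N_def)
        qed
      qed
      also have "\<dots> = ennreal B * (\<integral>\<^sup>+z. ennreal (k z) * indicator (ball 0 1) z \<partial>lborel)"
      proof (rule nn_integral_cmult)
        have "(\<lambda>z. ennreal (k z)) \<in> borel_measurable lborel" using km by measurable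
        then show "(\<lambda>z. ennreal (k z) * indicator (ball 0 1) z) \<in> borel_measurable lborel"
          using bm by (intro borel_measurable_times_ennreal borel_measurable_indicator) auto
      qed
      also have "\<dots> \<le> ennreal B * ennreal (C2 * (1 - (norm (a j))\<^sup>2) powr (- (\<epsilon> * (p - 1))))"
        unfolding k_def by (intro mult_left_mono C2[rule_format] a) simp
      also have "\<dots> = ennreal (B * (C2 * (1 - (norm (a j))\<^sup>2) powr (- (\<epsilon> * (p - 1)))))"
        by (rule ennreal_mult'[symmetric, OF B0])
      also have "B * (C2 * (1 - (norm (a j))\<^sup>2) powr (- (\<epsilon> * (p - 1)))) = C1 powr (p - 1) * C2 * h j powr (p - 1)"
      proof -
        have e: "s + - (\<epsilon> * (p - 1)) = (\<sigma> / p - \<epsilon>) * (p - 1)" unfolding s using p by (simp add: field_simps)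
        have "l (a j) powr s * l (a j) powr (- (\<epsilon> * (p - 1))) = h j powr (p - 1)"
          unfolding h_def powr_powr powr_add[symmetric] e ..
        then show ?thesis unfolding B_def l_def[symmetric] by (simp add: mult_ac)
      qed
      finally show ?thesis .
    qed
    show "summable (\<lambda>j. N z j * x j)" for z
    proof (cases "norm z < 1")
      case True
      then show ?thesis using sm[OF True] unfolding N_def l_def by simp
    qed (simp add: N_def)
    show "0 < h j" for j unfolding h_def using l[of j] by simp
    show "0 \<le> G z" for z unfolding G_def using C10 by simp
    show "0 \<le> C1 powr (p - 1) * C2" using C20 by simp
  qed (use p x N0 in auto)
  also have "\<dots> < \<infinity>" using x(2) by (simp add: ennreal_mult_less_top)
  finally have fin: "(\<integral>\<^sup>+z. ennreal ((\<Sum>j. N z j * x j) powr p) \<partial>Mu) < \<infinity>" .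
  have "(\<integral>\<^sup>+z. ennreal (l z powr (\<alpha> * p) * (\<Sum>j. l (a j) powr s * norm (1 - cinner z (a j)) powr (- \<sigma>) * x j) powr p) * indicator (ball 0 1) z \<partial>lborel)
     \<le> (\<integral>\<^sup>+z. ennreal (l z powr (\<alpha> * p)) * ennreal ((\<Sum>j. N z j * x j) powr p) \<partial>lborel)"
  proof (rule nn_integral_mono)
    fix z
    show "ennreal (l z powr (\<alpha> * p) * (\<Sum>j. l (a j) powr s * norm (1 - cinner z (a j)) powr (- \<sigma>) * x j) powr p) * indicator (ball 0 1) z
       \<le> ennreal (l z powr (\<alpha> * p)) * ennreal ((\<Sum>j. N z j * x j) powr p)"
    proof (cases "norm z < 1")
      case True
      then have "N z j = l (a j) powr s * norm (1 - cinner z (a j)) powr (- \<sigma>)" for j by (simp add: N_def)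
      moreover have "ennreal (l z powr (\<alpha> * p) * y) = ennreal (l z powr (\<alpha> * p)) * ennreal y" for y
        by (rule ennreal_mult') simp
      ultimately show ?thesis using True by simp
    qed simp
  qed
  also have "\<dots> = (\<integral>\<^sup>+z. ennreal ((\<Sum>j. N z j * x j) powr p) \<partial>Mu)"
    unfolding Mu_def by (rule nn_integral_density[symmetric]) measurable
  also note fin
  finally show ?thesis unfolding l_def .
qed

section \<open>Schur's test for matrices\<close>

text \<open>Counting measure with \<open>h = 1\<close> and constant \<open>G\<close>. Convergence of
  each row against \<open>x\<close> comes first: p-summable sequences are bounded and the rows of
  \<open>A\<close> are summable.\<close>

lemma schur_test_matrix:
  fixes A :: "nat \<Rightarrow> nat \<Rightarrow> real" and x :: "nat \<Rightarrow> real"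
  assumes p: "1 < p" and A: "\<And>k j. 0 \<le> A k j" and R: "0 \<le> R" and C: "0 \<le> C"
    and row: "\<And>k. (\<Sum>j. ennreal (A k j)) \<le> ennreal R"
    and col: "\<And>j. (\<Sum>k. ennreal (A k j)) \<le> ennreal C"
    and x: "\<And>j. 0 \<le> x j" "0 \<le> B" "(\<Sum>j. ennreal (x j powr p)) \<le> ennreal B"
  shows "summable (\<lambda>j. A k j * x j)"
    and "(\<Sum>k. ennreal ((\<Sum>j. A k j * x j) powr p)) \<le> ennreal (C * R powr (p - 1) * B)"
proof -
  have sA: "summable (A k)" for k
  proof (rule summable_suminf_not_top[OF A])
    show "(\<Sum>j. ennreal (A k j)) \<noteq> top" using row[of k] by (metis ennreal_less_top infinity_ennreal_def leD)
  qed
  have sm: "summable (\<lambda>j. A k j * x j)" for k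
  proof (rule summable_comparison_test'[where N=0])
    show "summable (\<lambda>j. A k j * B powr (1 / p))" by (rule summable_mult2[OF sA])
    have "x j \<le> B powr (1 / p)" for j using p by (intro le_of_suminf_powr_le x) simp
    then show "norm (A k j * x j) \<le> A k j * B powr (1 / p)" for j
      using A[of k j] x(1)[of j] by (simp add: mult_left_mono)
  qed
  then show "summable (\<lambda>j. A k j * x j)" .
  have "(\<integral>\<^sup>+k. ennreal ((\<Sum>j. A k j * x j) powr p) \<partial>count_space UNIV) \<le> ennreal (C * R powr (p - 1)) * (\<Sum>j. ennreal (x j powr p))"
  proof (rule schur_test[where h="\<lambda>_. 1" and G="\<lambda>_. R"])
    show "(\<Sum>j. ennreal (A k j * 1)) \<le> ennreal R" for k using row[of k] by simp
    show "(\<integral>\<^sup>+k. ennreal (A k j * R powr (p - 1)) \<partial>count_space UNIV) \<le> ennreal (C * R powr (p - 1) * 1 powr (p - 1))" for j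
    proof -
      have "(\<integral>\<^sup>+k. ennreal (A k j * R powr (p - 1)) \<partial>count_space UNIV) = (\<Sum>k. ennreal (A k j) * ennreal (R powr (p - 1)))"
        using A by (simp add: nn_integral_count_space_nat ennreal_mult)
      also have "\<dots> = (\<Sum>k. ennreal (A k j)) * ennreal (R powr (p - 1))" by (rule ennreal_suminf_multc)
      also have "\<dots> \<le> ennreal C * ennreal (R powr (p - 1))" by (intro mult_right_mono col) simp
      also have "\<dots> = ennreal (C * R powr (p - 1) * 1 powr (p - 1))" using C by (simp add: ennreal_mult)
      finally show ?thesis .
    qed
  qed (use p A R C x(1) sm in auto)
  also have "\<dots> \<le> ennreal (C * R powr (p - 1)) * ennreal B" by (intro mult_left_mono x) simp
  also have "\<dots> = ennreal (C * R powr (p - 1) * B)" using C by (intro ennreal_mult'[symmetric]) simp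
  finally show "(\<Sum>k. ennreal ((\<Sum>j. A k j * x j) powr p)) \<le> ennreal (C * R powr (p - 1) * B)"
    unfolding nn_integral_count_space_nat .
qed

section \<open>Interpolation\<close>

theorem theorem4p5:
  fixes a :: "nat \<Rightarrow> complex ^ 'n" and p q \<alpha> \<beta> c1 c2 :: real
  assumes "1 < p" and "1 / p + 1 / q = 1"
    and "\<alpha> > - 1 / p" and "\<beta> = \<alpha> * p / q"
    and "\<forall>k. a k \<in> ball 0 1"
    and "c1 > 0" and "c2 > 0" and "c1 * c2 < 1"
    and "Kconst a ((real CARD('n) + 1) / p + \<alpha>) ((real CARD('n) + 1) / q + \<beta>) \<le> ennreal (c1 powr q)"
    and "Kconst a ((real CARD('n) + 1) / q + \<beta>) ((real CARD('n) + 1) / p + \<alpha>) \<le> ennreal (c2 powr p)"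
  shows "interpolating p \<alpha> a"
proof -
  define r where "r = (real CARD('n) + 1) / p + \<alpha>"
  define s where "s = (real CARD('n) + 1) / q + \<beta>"
  define \<sigma> where "\<sigma> = real CARD('n) + 1 + \<alpha> * p"
  note p = \<open>1 < p\<close>
  have a: "norm (a k) < 1" for k using assms(5) by simp
  have K1: "Kconst a r s \<le> ennreal (c1 powr q)" and K2: "Kconst a s r \<le> ennreal (c2 powr p)"
    using assms(9,10) unfolding r_def s_def .
  have iq: "1 / q = (p - 1) / p" using assms(2) p by (simp add: field_simps)
  then have q0: "q \<noteq> 0" using p by auto
  \<comment> \<open>This identity turns the row bound, raised to the power \<open>p - 1\<close>,
    into \<open>c1 powr p\<close>.\<close>
  have qp: "q * (p - 1) = p" using iq q0 p by (simp add: field_simps)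
  have rp: "r * p = \<sigma>" unfolding r_def \<sigma>_def using p by (simp add: field_simps)
  then have r\<sigma>: "r = \<sigma> / p" using p by (simp add: field_simps)
  have s1: "s = (real CARD('n) + 1) * (1 / q) + \<alpha> * p * (1 / q)" unfolding s_def assms(4) by simp
  have s\<sigma>: "s = \<sigma> - \<sigma> / p" unfolding s1 iq \<sigma>_def using p by (simp add: field_simps)
  have rs: "r + s = \<sigma>" unfolding r\<sigma> s\<sigma> by simp
  have \<alpha>p: "\<alpha> * p > - 1" using assms(3) p by (simp add: field_simps)
  have \<sigma>0: "\<sigma> > 0" unfolding \<sigma>_def using \<alpha>p by linarith
  have r0: "r > 0" unfolding r\<sigma> using \<sigma>0 p by simp
  have s0: "s > 0"
  proof -
    have "s = \<sigma> * (p - 1) / p" unfolding s\<sigma> using p by (simp add: field_simps)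
    then show ?thesis using \<sigma>0 p by simp
  qed
  define l where "l j = 1 - (norm (a j))\<^sup>2" for j
  have l: "0 < l j" for j unfolding l_def by (rule defect_pos[OF a])
  define k where "k z j = (1 - cinner z (a j)) powr (- complex_of_real \<sigma>)" for z j
  have nk: "norm (k z j) = norm (1 - cinner z (a j)) powr (- \<sigma>)" for z j
    unfolding k_def by (rule norm_kernel_powr)
  \<comment> \<open>The weights are split as \<open>r\<close> on the row index and \<open>s\<close>
    on the column index, so the row sums are those of the first constant and the column sums those
    of the second, with exponents interchanged.\<close>
  define A where "A i j = (if j = i then 0 else complex_of_real (l i powr r * l j powr s) * k (a i) j)" for i j
  have nA: "norm (A i j) = (if j = i then 0 else l i powr r * l j powr s / norm (1 - cinner (a j) (a i)) powr \<sigma>)" for i j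
    unfolding A_def by (simp add: norm_mult nk powr_minus_divide norm_one_minus_cinner_commute[of "a i" "a j"])
  have row: "(\<Sum>j. ennreal (norm (A i j))) \<le> ennreal (c1 powr q)" for i
  proof -
    have "(\<Sum>j. ennreal (norm (A i j))) = (\<Sum>j. if j = i then 0 else
      ennreal ((1 - (norm (a i))\<^sup>2) powr r * (1 - (norm (a j))\<^sup>2) powr s / (norm (1 - cinner (a j) (a i))) powr (r + s)))"
      unfolding nA rs l_def by (intro arg_cong[where f=suminf] ext) simp
    also have "\<dots> \<le> ennreal (c1 powr q)" by (rule Kconst_row[OF K1])
    finally show ?thesis .
  qed
  have col: "(\<Sum>i. ennreal (norm (A i j))) \<le> ennreal (c2 powr p)" for j
  proof -
    have "(\<Sum>i. ennreal (norm (A i j))) = (\<Sum>i. if i = j then 0 else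
      ennreal ((1 - (norm (a j))\<^sup>2) powr s * (1 - (norm (a i))\<^sup>2) powr r / (norm (1 - cinner (a i) (a j))) powr (s + r)))"
      unfolding nA add.commute[of s r] rs l_def
      by (intro arg_cong[where f=suminf] ext) (simp add: mult.commute norm_one_minus_cinner_commute)
    also have "\<dots> \<le> ennreal (c2 powr p)" by (rule Kconst_row[OF K2])
    finally show ?thesis .
  qed
  have \<theta>: "c2 powr p * (c1 powr q) powr (p - 1) = (c1 * c2) powr p"
    using assms(6,7) by (simp add: powr_powr qp powr_mult)
  have overlap: "(\<Sum>j. indicator (nbhd (a j)) w) \<le> ennreal (1 + 32 powr (r + s) * c1 powr q)" for w
    by (rule nbhd_overlap[OF a r0 s0 K1]) simp
  have sls: "summable (\<lambda>j. l j powr s)"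
  \<comment> \<open>Row 0 of \<open>A\<close> alone controls \<open>l j powr s\<close>, because
    \<open>|1 - <a j, a 0>|\<close> is at most 2. The comparison starts at 1 because the diagonal
    entry of \<open>A\<close> is zero.\<close>
  proof (rule summable_comparison_test'[where N=1])
    have "summable (\<lambda>j. norm (A 0 j))"
    proof (rule summable_suminf_not_top)
      show "(\<Sum>j. ennreal (norm (A 0 j))) \<noteq> top" using row[of 0] by (metis ennreal_less_top infinity_ennreal_def leD)
    qed simp
    then show "summable (\<lambda>j. 2 powr \<sigma> / l 0 powr r * norm (A 0 j))" by (rule summable_mult)
    show "norm (l j powr s) \<le> 2 powr \<sigma> / l 0 powr r * norm (A 0 j)" if "1 \<le> j" for j
    proof -
      let ?d = "norm (1 - cinner (a j) (a 0))"
      have d0: "0 < ?d" using a[of j] a[of 0] by (intro kernel_pos) auto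
      have "norm (cinner (a j) (a 0)) \<le> 1 * 1"
        by (rule order_trans[OF norm_cinner_le]) (use a[of j] a[of 0] in \<open>intro mult_mono, auto\<close>)
      then have "?d \<le> 2" using norm_triangle_ineq4[of 1 "cinner (a j) (a 0)"] by simp
      then have "?d powr \<sigma> \<le> 2 powr \<sigma>" using \<sigma>0 by (intro powr_mono2) auto
      then have "l j powr s * 1 \<le> l j powr s * (2 powr \<sigma> / ?d powr \<sigma>)"
        using d0 by (intro mult_left_mono) auto
      also have "\<dots> = 2 powr \<sigma> / l 0 powr r * norm (A 0 j)"
        using that l[of 0] by (simp add: nA)
      finally show ?thesis by simp
    qed
  qed
  show ?thesis unfolding interpolating_def r_def[symmetric]
  proof (intro allI impI)
    fix v assume v: "in_lp p r a v"
    \<comment> \<open>With this weight the data hypothesis becomes plain p-summability of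
      \<open>w\<close>.\<close>
    define w where "w i = complex_of_real (l i powr r) * v i" for i
    have w: "(\<Sum>i. ennreal (norm (w i) powr p)) < \<infinity>"
      using v unfolding in_lp_def w_def l_def by (simp add: norm_mult)
    obtain u where u: "(\<Sum>i. ennreal (norm (u i) powr p)) < \<infinity>" and uw: "\<And>i. u i + (\<Sum>j. A i j * u j) = w i"
    proof (rule neumann_series_lp[of p "c1 * c2" A w])
      show "summable (\<lambda>j. norm (A i j) * x j)" if "\<And>j. 0 \<le> x j" "0 \<le> B" "(\<Sum>j. ennreal (x j powr p)) \<le> ennreal B" for x B i
        by (rule schur_test_matrix(1)[OF p _ _ _ row col that]) auto
      show "(\<Sum>i. ennreal ((\<Sum>j. norm (A i j) * x j) powr p)) \<le> ennreal ((c1 * c2) powr p * B)"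
        if "\<And>j. 0 \<le> x j" "0 \<le> B" "(\<Sum>j. ennreal (x j powr p)) \<le> ennreal B" for x B
        unfolding \<theta>[symmetric] by (rule schur_test_matrix(2)[OF p _ _ _ row col that]) auto
      show "1 < p" "c1 * c2 < 1" "0 < c1 * c2" using assms(6,7,8) p by auto
    qed (use w that in blast)+
    obtain B where B: "0 \<le> B" "(\<Sum>i. ennreal (norm (u i) powr p)) = ennreal B"
      using u by (metis ennreal_cases infinity_ennreal_def less_irrefl)
    have ub: "norm (u j) \<le> B powr (1 / p)" for j
      using p B(1) by (intro le_of_suminf_powr_le[of p "\<lambda>j. norm (u j)"] order.refl[THEN ord_eq_le_trans[OF B(2)]]) auto
    have sA: "summable (\<lambda>j. A i j * u j)" for i
    proof (rule summable_norm_cancel)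
      have "summable (\<lambda>j. norm (A i j) * norm (u j))"
        by (rule schur_test_matrix(1)[OF p _ _ _ row col _ B(1) eq_refl[OF B(2)]]) auto
      then show "summable (\<lambda>j. norm (A i j * u j))" by (simp add: norm_mult)
    qed
    define \<kappa> where "\<kappa> j = complex_of_real (l j powr s) * u j" for j
    have s\<kappa>: "summable (\<lambda>j. norm (\<kappa> j))"
    proof (rule summable_comparison_test'[where N=0])
      show "summable (\<lambda>j. l j powr s * B powr (1 / p))" by (rule summable_mult2[OF sls])
      show "norm (norm (\<kappa> j)) \<le> l j powr s * B powr (1 / p)" for j
        unfolding \<kappa>_def by (simp add: norm_mult mult_left_mono ub)
    qed
    define f where "f z = (\<Sum>j. \<kappa> j * k z j)" for z
    have sf: "summable (\<lambda>j. norm (\<kappa> j * k z j))" if "norm z < 1" for z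
      unfolding k_def by (rule kernel_series(1)[OF a \<sigma>0 s\<kappa> that])
    have nterm: "norm (\<kappa> j * k z j) = l j powr s * norm (1 - cinner z (a j)) powr (- \<sigma>) * norm (u j)" for z j
      unfolding \<kappa>_def by (simp add: norm_mult nk)
    have "holo_on f (ball 0 1)"
      unfolding f_def k_def by (rule kernel_series(2)[OF a \<sigma>0 s\<kappa>])
    moreover have "(\<integral>\<^sup>+ z \<in> ball 0 1. ennreal ((1 - (norm z)\<^sup>2) powr (\<alpha> * p) * norm (f z) powr p) \<partial>lborel) < \<infinity>"
    proof -
      have "(\<integral>\<^sup>+ z \<in> ball 0 1. ennreal ((1 - (norm z)\<^sup>2) powr (\<alpha> * p) * norm (f z) powr p) \<partial>lborel)
        \<le> (\<integral>\<^sup>+z. ennreal ((1 - (norm z)\<^sup>2) powr (\<alpha> * p) *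
      (\<Sum>j. (1 - (norm (a j))\<^sup>2) powr s * norm (1 - cinner z (a j)) powr (- \<sigma>) * norm (u j)) powr p) * indicator (ball 0 1) z \<partial>lborel)"
      proof (rule nn_integral_mono)
        fix z
        show "ennreal ((1 - (norm z)\<^sup>2) powr (\<alpha> * p) * norm (f z) powr p) * indicator (ball 0 1) z
          \<le> ennreal ((1 - (norm z)\<^sup>2) powr (\<alpha> * p) *
      (\<Sum>j. (1 - (norm (a j))\<^sup>2) powr s * norm (1 - cinner z (a j)) powr (- \<sigma>) * norm (u j)) powr p) * indicator (ball 0 1) z"
        proof (cases "norm z < 1")
          case True
          have "norm (f z) \<le> (\<Sum>j. norm (\<kappa> j * k z j))" unfolding f_def by (rule summable_norm[OF sf[OF True]])
          also have "\<dots> = (\<Sum>j. (1 - (norm (a j))\<^sup>2) powr s * norm (1 - cinner z (a j)) powr (- \<sigma>) * norm (u j))"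
            unfolding nterm l_def ..
          finally have "norm (f z) powr p \<le> \<dots> powr p" using p by (intro powr_mono2) auto
          then show ?thesis by (intro mult_right_mono ennreal_leI mult_left_mono) auto
        qed simp
      qed
      also have "\<dots> < \<infinity>"
      proof (rule kernel_synthesis_Bp[OF p \<alpha>p a _ overlap \<sigma>_def s\<sigma> _ u])
        show "summable (\<lambda>j. (1 - (norm (a j))\<^sup>2) powr s * norm (1 - cinner z (a j)) powr (- \<sigma>) * norm (u j))" if "norm z < 1" for z
          using sf[OF that] unfolding nterm l_def .
      qed auto
      finally show ?thesis .
    qed
    ultimately have "in_Bp p \<alpha> f" unfolding in_Bp_def by blast
    moreover have "f (a i) = v i" for i
    proof -
      \<comment> \<open>On the diagonal the kernel is a power of the defect, and
        \<open>r + s = \<sigma>\<close> makes all powers cancel.\<close>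
      have diag: "complex_of_real (l i powr r) * (\<kappa> i * k (a i) i) = u i"
      proof -
        have "1 - cinner (a i) (a i) = complex_of_real (l i)" by (simp add: cinner_self l_def)
        then have "k (a i) i = complex_of_real (l i) powr complex_of_real (- \<sigma>)" unfolding k_def by simp
        also have "\<dots> = complex_of_real (l i powr (- \<sigma>))" using l[of i] by (subst powr_of_real) auto
        finally have ki: "k (a i) i = complex_of_real (l i powr (- \<sigma>))" .
        have "l i powr r * l i powr s * l i powr (- \<sigma>) = 1"
          using l[of i] rs by (simp add: powr_add[symmetric])
        then have "complex_of_real (l i powr r) * complex_of_real (l i powr s) * complex_of_real (l i powr (- \<sigma>)) = 1"
          by (metis of_real_1 of_real_mult)
        then show ?thesis unfolding \<kappa>_def ki by (simp add: mult_ac)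
      qed
      \<comment> \<open>The diagonal term, which \<open>A\<close> omits, is restored as a one-term
        series, so the weighted value of \<open>f\<close> is the left side of the solved
        equation.\<close>
      have e: "complex_of_real (l i powr r) * (\<kappa> j * k (a i) j) = A i j * u j + (if j = i then u i else 0)" for j
        using diag by (auto simp: A_def \<kappa>_def)
      have sing: "(\<lambda>j. if j = i then u i else 0) sums u i"
        using sums_single[of i "\<lambda>_. u i"] by simp
      have "complex_of_real (l i powr r) * f (a i) = (\<Sum>j. complex_of_real (l i powr r) * (\<kappa> j * k (a i) j))"
        unfolding f_def by (rule suminf_mult[symmetric]) (rule summable_norm_cancel[OF sf[OF a]])
      also have "\<dots> = (\<Sum>j. A i j * u j + (if j = i then u i else 0))" unfolding e ..
      also have "\<dots> = (\<Sum>j. A i j * u j) + (\<Sum>j. if j = i then u i else 0)"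
        by (rule suminf_add[symmetric, OF sA sums_summable[OF sing]])
      also have "(\<Sum>j. if j = i then u i else 0) = u i" by (rule sums_unique[symmetric, OF sing])
      also have "(\<Sum>j. A i j * u j) + u i = complex_of_real (l i powr r) * v i"
        using uw[of i] unfolding w_def by (simp add: add.commute)
      finally show ?thesis using l[of i] by simp
    qed
    ultimately show "\<exists>f. in_Bp p \<alpha> f \<and> (\<forall>k. f (a k) = v k)" by blast
  qed
qed

end
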